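(* Let $Q$ be a compatible pointed irregular type, and let $\mathbb V^\flat$ and $\mathbf B_v$ ($v\in\mathbb V^\flat$) be as in the context. Then the pure local wild mapping class group $\Gamma(Q)=\pi_1(\mathbf B(Q))$ satisfies $$\Gamma(Q)\cong\prod_{v\in\mathbb V^\flat}\pi_1(\mathbf B_v),$$ and each factor is trivial or isomorphic to $\pi_1(X_n)$ (the pure braid group on $n$ strands) or to $\pi_1(X^*_{n,N})$, where $X_n=\{(a_1,\dots,a_n)\in\mathbb C^n:a_i\ne a_j\ (i\ne j)\}$ and $X^*_{n,N}=\{(a_1,\dots,a_n)\in\mathbb C^n:a_i\ne0,\ a_i\ne\zeta a_j\ (i\ne j,\ \zeta^N=1)\}$.
   Context: Exponential factors: finite sums $q=\sum_ka_kx^k$, $a_k\in\mathbb C$, $k\in\mathbb Q_{>0}$; $\mathrm{slope}(q)$ = largest exponent with nonzero coefficient; $\mathrm{ram}(q)$ = least $r\ge1$ with $q\in x^{1/r}\mathbb C[x^{1/r}]$. Galois operator $\sigma(\sum a_kx^k)=\sum a_ke^{-2\pi\sqrt{-1}k}x^k$; Stokes circle $\langle q\rangle=\{\sigma^i(q)\}$. Truncation $\tau_k(\sum a_{k'}x^{k'})=\sum_{k'\ge k}a_{k'}x^{k'}$. $\mathrm{Levels}(q)=\{\mathrm{slope}(q-\sigma^i(q))\}\setminus\{0\}$. For $L=\{k_1>\dots>k_m\}$, $r_i$ = lcm of denominators of $k_1,\dots,k_i$, $A(L)=\mathbb N_{>0}\cup\bigcup_i((0,k_i]\cap\frac1{r_i}\mathbb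 N)$. Pointed irregular type $Q=[(n_1,q_1),\dots,(n_m,q_m)]$: $n_i\in\mathbb N_{>0}$, $q_i$ in distinct orbits; compatible if $\langle\tau_k(q_i)\rangle=\langle\tau_k(q_j)\rangle\Rightarrow\tau_k(q_i)=\tau_k(q_j)$. $Q'\sim Q$ means same length and multiplicities and $\mathrm{slope}(\sigma^k(q'_i)-\sigma^l(q'_j))=\mathrm{slope}(\sigma^k(q_i)-\sigma^l(q_j))$ for all $i,j$, $0\le k\le\mathrm{ram}(q_i)$, $0\le l\le\mathrm{ram}(q_j)$. $r=\mathrm{lcm}_i\mathrm{ram}(q_i)$, $K=\max_i\mathrm{slope}(q_i)$, $s=rK$, $Q_{\mathbf a}=[(n_i,\sum_{j=1}^sa_{i,j}x^{j/r})]$, $\mathbf B(Q)=\{\mathbf a\in\mathbb C^{ms}:Q_{\mathbf a}\sim Q\}$ (based at the point giving $Q$). Fission tree: $A(Q)=\bigcup_iA(\mathrm{Levels}(q_i))$; nodes of height $k\in A(Q)$ are the circles $\langle\tau_k(q_i)\rangle$; with $k^-$ the next smaller element of $A(Q)$, the parent of $\langle\tau_{k^-}(q_i)\rangle$ is $\langle\tau_k(q_i)\rangle$. A node $\langle\tau_k(q_i)\rangle$ is admissible if $k\in A(\mathrm{Levels}(q_i))$, mandatory if $k\in\mathrm{Levels}(q_i)$; $\mathrm{Ram}(\langle\tau_k(q_i)\rangle)=\mathrm{ram}(\tau_k(q_i))$; $N_v=\mathrm{lcm}(\mathrm{Ram}(v),b)/\mathrm{Ram}(v)$ with $b$ the denominator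 of the children's height. $\eta=\lfloor K\rfloor+1$; $\mathbb V^\flat$ = nodes of height in $A(Q)\cap(0,\eta]$. For $v\in\mathbb V^\flat$, $\mathbf B_v=\{c:\mathrm{Ch}_{\mathbb A}(v)\to\mathbb C\mid c(w)\ne0$ for mandatory $w$, $c(u)^{N_v}\ne c(w)^{N_v}$ for $u\ne w\}$, where $\mathrm{Ch}_{\mathbb A}(v)$ is the set of admissible children (a point if empty). *)

theory Defs
  imports "HOL-Analysis.Analysis" "HOL-Algebra.Product_Groups"
begin

definition loops_at :: "'a::topological_space set \<Rightarrow> 'a \<Rightarrow> (real \<Rightarrow> 'a) set" where
  "loops_at S x0 = {p. path p \<and> path_image p \<subseteq> S \<and> pathstart p = x0 \<and> pathfinish p = x0}"

definition fundamental_group :: "'a::topological_space set \<Rightarrow> 'a \<Rightarrow> ((real \<Rightarrow> 'a) set) monoid" where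
  "fundamental_group S x0 =
    \<lparr> carrier = (\<lambda>p. {q. homotopic_paths S p q}) ` loops_at S x0,
      monoid.mult = (\<lambda>A B. {q. \<exists>p\<in>A. \<exists>p'\<in>B. homotopic_paths S (p +++ p') q}),
      one = {q. homotopic_paths S (\<lambda>t. x0) q} \<rparr>"

text \<open>An exponential factor sum a_k x^k (k positive rational) is encoded by its coefficient
  function k -> a_k, with finite support contained in the positive rationals.\<close>

type_synonym ef = "rat \<Rightarrow> complex"

definition is_ef :: "ef \<Rightarrow> bool" where
  "is_ef q \<longleftrightarrow> finite {k. q k \<noteq> 0} \<and> (\<forall>k. q k \<noteq> 0 \<longrightarrow> 0 < k)"

definition slope :: "ef \<Rightarrow> rat" where
  "slope q = (if {k. q k \<noteq> 0} = {} then 0 else Max {k. q k \<noteq> 0})"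

definition ram :: "ef \<Rightarrow> nat" where
  "ram q = (LEAST r::nat. 1 \<le> r \<and> (\<forall>k. q k \<noteq> 0 \<longrightarrow> of_nat r * k \<in> \<int>))"

definition gal :: "ef \<Rightarrow> ef" where
  "gal q = (\<lambda>k. q k * cis (- 2 * pi * of_rat k))"

definition circ :: "ef \<Rightarrow> ef set" where
  "circ q = range (\<lambda>i. (gal ^^ i) q)"

definition trunc :: "rat \<Rightarrow> ef \<Rightarrow> ef" where
  "trunc k q = (\<lambda>k'. if k \<le> k' then q k' else 0)"

definition levels :: "ef \<Rightarrow> rat set" where
  "levels q = (\<lambda>i. slope (\<lambda>x. q x - (gal ^^ i) q x)) ` UNIV - {0}"

definition denom :: "rat \<Rightarrow> nat" where
  "denom k = nat (snd (quotient_of k))"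

definition rlev :: "rat set \<Rightarrow> rat \<Rightarrow> nat" where
  "rlev L k = Lcm (denom ` {k'\<in>L. k \<le> k'})"

definition Aset :: "rat set \<Rightarrow> rat set" where
  "Aset L = {x. \<exists>n::nat. 0 < n \<and> x = of_nat n}
     \<union> (\<Union>k\<in>L. {x. 0 < x \<and> x \<le> k \<and> (\<exists>n::nat. x = of_nat n / of_nat (rlev L k))})"

type_synonym pit = "(nat \<times> ef) list"

definition is_pit :: "pit \<Rightarrow> bool" where
  "is_pit Q \<longleftrightarrow> (\<forall>i<length Q. 0 < fst (Q!i) \<and> is_ef (snd (Q!i)))
     \<and> (\<forall>i<length Q. \<forall>j<length Q. i \<noteq> j \<longrightarrow> snd (Q!j) \<notin> circ (snd (Q!i)))"

definition compatible :: "pit \<Rightarrow> bool" where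
  "compatible Q \<longleftrightarrow> (\<forall>i<length Q. \<forall>j<length Q. \<forall>k.
      circ (trunc k (snd (Q!i))) = circ (trunc k (snd (Q!j)))
        \<longrightarrow> trunc k (snd (Q!i)) = trunc k (snd (Q!j)))"

definition pit_equiv :: "pit \<Rightarrow> pit \<Rightarrow> bool" where
  "pit_equiv Q' Q \<longleftrightarrow> length Q' = length Q
     \<and> (\<forall>i<length Q. fst (Q'!i) = fst (Q!i))
     \<and> (\<forall>i<length Q. \<forall>j<length Q. \<forall>k\<le>ram (snd (Q!i)). \<forall>l\<le>ram (snd (Q!j)).
          slope (\<lambda>x. (gal ^^ k) (snd (Q'!i)) x - (gal ^^ l) (snd (Q'!j)) x)
        = slope (\<lambda>x. (gal ^^ k) (snd (Q!i)) x - (gal ^^ l) (snd (Q!j)) x))"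

definition rQ :: "pit \<Rightarrow> nat" where
  "rQ Q = Lcm ((\<lambda>p. ram (snd p)) ` set Q)"

definition KQ :: "pit \<Rightarrow> rat" where
  "KQ Q = (if Q = [] then 0 else Max ((\<lambda>p. slope (snd p)) ` set Q))"

definition sQ :: "pit \<Rightarrow> nat" where
  "sQ Q = nat \<lfloor>of_nat (rQ Q) * KQ Q\<rfloor>"

text \<open>Coefficient vectors a in C^{ms} are encoded as functions (i,j) -> a_{i,j}
  vanishing outside 0 <= i < m, 1 <= j <= s.\<close>
definition Qa :: "pit \<Rightarrow> (nat \<times> nat \<Rightarrow> complex) \<Rightarrow> pit" where
  "Qa Q a = map (\<lambda>i. (fst (Q!i),
      (\<lambda>k. if (\<exists>j\<in>{1..sQ Q}. k = of_nat j / of_nat (rQ Q))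
           then a (i, nat \<lfloor>k * of_nat (rQ Q)\<rfloor>) else 0))) [0..<length Q]"

definition BQ :: "pit \<Rightarrow> (nat \<times> nat \<Rightarrow> complex) set" where
  "BQ Q = {a. (\<forall>i j. a (i,j) \<noteq> 0 \<longrightarrow> i < length Q \<and> 1 \<le> j \<and> j \<le> sQ Q)
              \<and> pit_equiv (Qa Q a) Q}"

definition baseQ :: "pit \<Rightarrow> (nat \<times> nat \<Rightarrow> complex)" where
  "baseQ Q = (\<lambda>(i,j). if i < length Q \<and> 1 \<le> j \<and> j \<le> sQ Q
                       then snd (Q!i) (of_nat j / of_nat (rQ Q)) else 0)"

definition Gamma :: "pit \<Rightarrow> ((real \<Rightarrow> (nat \<times> nat \<Rightarrow> complex)) set) monoid" where
  "Gamma Q = fundamental_group (BQ Q) (baseQ Q)"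

text \<open>A node is a pair (height, Stokes circle).\<close>
type_synonym node = "rat \<times> ef set"

definition AQ :: "pit \<Rightarrow> rat set" where
  "AQ Q = (\<Union>p\<in>set Q. Aset (levels (snd p)))"

definition prevh :: "pit \<Rightarrow> rat \<Rightarrow> rat" where
  "prevh Q k = Max {k'\<in>AQ Q. k' < k}"

definition eta :: "pit \<Rightarrow> rat" where
  "eta Q = of_int \<lfloor>KQ Q\<rfloor> + 1"

definition Vflat :: "pit \<Rightarrow> node set" where
  "Vflat Q = {(k, circ (trunc k (snd p))) | k p. k \<in> AQ Q \<and> 0 < k \<and> k \<le> eta Q \<and> p \<in> set Q}"

definition children :: "pit \<Rightarrow> node \<Rightarrow> node set" where
  "children Q v = (if {k'\<in>AQ Q. k' < fst v} = {} then {}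
     else {(prevh Q (fst v), circ (trunc (prevh Q (fst v)) (snd p))) | p.
             p \<in> set Q \<and> circ (trunc (fst v) (snd p)) = snd v})"

definition admissible :: "pit \<Rightarrow> node \<Rightarrow> bool" where
  "admissible Q w \<longleftrightarrow> (\<exists>p\<in>set Q. snd w = circ (trunc (fst w) (snd p))
                        \<and> fst w \<in> Aset (levels (snd p)))"

definition mandatory :: "pit \<Rightarrow> node \<Rightarrow> bool" where
  "mandatory Q w \<longleftrightarrow> (\<exists>p\<in>set Q. snd w = circ (trunc (fst w) (snd p))
                        \<and> fst w \<in> levels (snd p))"

definition ChA :: "pit \<Rightarrow> node \<Rightarrow> node set" where
  "ChA Q v = {w \<in> children Q v. admissible Q w}"

definition RamN :: "node \<Rightarrow> nat" where
  "RamN v = ram (SOME q. q \<in> snd v)"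

definition Nv :: "pit \<Rightarrow> node \<Rightarrow> nat" where
  "Nv Q v = lcm (RamN v) (denom (prevh Q (fst v))) div RamN v"

text \<open>B_v: functions on the admissible children (encoded as functions on all nodes
  vanishing off ChA; if ChA is empty this is a point).\<close>
definition Bv :: "pit \<Rightarrow> node \<Rightarrow> (node \<Rightarrow> complex) set" where
  "Bv Q v = {c. (\<forall>w. w \<notin> ChA Q v \<longrightarrow> c w = 0)
      \<and> (\<forall>w\<in>ChA Q v. mandatory Q w \<longrightarrow> c w \<noteq> 0)
      \<and> (\<forall>u\<in>ChA Q v. \<forall>w\<in>ChA Q v. u \<noteq> w \<longrightarrow> c u ^ Nv Q v \<noteq> c w ^ Nv Q v)}"

text \<open>Points of C^n encoded as functions nat -> complex vanishing at indices >= n.\<close>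
definition Xconf :: "nat \<Rightarrow> (nat \<Rightarrow> complex) set" where
  "Xconf n = {a. (\<forall>i\<ge>n. a i = 0) \<and> (\<forall>i<n. \<forall>j<n. i \<noteq> j \<longrightarrow> a i \<noteq> a j)}"

definition Xstar :: "nat \<Rightarrow> nat \<Rightarrow> (nat \<Rightarrow> complex) set" where
  "Xstar n N = {a. (\<forall>i\<ge>n. a i = 0) \<and> (\<forall>i<n. a i \<noteq> 0)
     \<and> (\<forall>i<n. \<forall>j<n. i \<noteq> j \<longrightarrow> (\<forall>\<zeta>::complex. \<zeta> ^ N = 1 \<longrightarrow> a i \<noteq> \<zeta> * a j))}"

end

theory Submission
  imports Defs "HOL-Library.Real_Mod"
begin

text \<open>Fixing the slope of a difference of two exponential factors imposes one condition on the
  coefficients at each exponent \<open>e\<close> separately, so \<open>BQ\<close> is a product over the exponents. By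
  compatibility, two Galois conjugates of \<open>q i\<close> and \<open>q j\<close> agree above \<open>e\<close> only if \<open>q i\<close> and \<open>q j\<close>
  themselves do, with the Galois shift a multiple of the ramification there; that shift acts on
  the coefficient at \<open>e\<close> by powers of a primitive root of unity of order \<open>Nv\<close>. Hence the factor at \<open>e\<close>
  is in turn the product of the \<open>Bv\<close> over the nodes \<open>v\<close> whose children have height \<open>e\<close>, and the
  fundamental group of a product is the product of the fundamental groups. Each \<open>Bv\<close> is
  path-connected, so base points do not matter. Finally, if \<open>Nv = 1\<close> then no child is mandatory,
  and otherwise every admissible child is: \<open>Bv\<close> is \<open>Xconf\<close> or \<open>Xstar\<close>.\<close>

section \<open>Fundamental groups\<close>

text \<open>The conditions at an exponent are independent of all other unknown coefficients because
  \<open>Q\<close> alone decides where a difference has to vanish and where it must not. Admissible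
  and mandatory nodes are handled as divisibility statements: \<open>denom e\<close> divides the
  ramification of \<open>trunc e q\<close> or, respectively, does so without dividing that of the
  part strictly above \<open>e\<close>. An obstacle is that \<open>pit_equiv\<close> tests only
  shifts up to the ramification, whereas siblings must be separated up to all \<open>Nv\<close>-th
  roots of unity. The range suffices: the ramification above \<open>e\<close> times
  \<open>Nv\<close> is an lcm that divides \<open>ram (q j)\<close> once \<open>q j e\<close> is
  nonzero, and of two siblings at least one has a nonzero coefficient at \<open>e\<close>. Also,
  \<open>Bv\<close> sees admissible children only. At a non-admissible node the coefficient is
  forced to be 0, and an admissible sibling of such a node is mandatory, so these two are separated
  automatically. The bound \<open>eta\<close> is the least integer above \<open>KQ\<close>. Integers
  are heights, so each admissible height up to \<open>KQ\<close> has a parent in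
  \<open>Vflat\<close>; conversely, beyond all exponents only integers are admissible, so admissible
  children never lie above \<open>KQ\<close>.\<close>

definition path_class :: "'a::topological_space set \<Rightarrow> (real \<Rightarrow> 'a) \<Rightarrow> (real \<Rightarrow> 'a) set" where
  "path_class S p = {q. homotopic_paths S p q}"

lemma path_class_eqI: "homotopic_paths S p q \<Longrightarrow> path_class S p = path_class S q"
  unfolding path_class_def using homotopic_paths_trans homotopic_paths_sym by blast

text \<open>Homotopy is reflexive only on paths that stay in \<open>S\<close>; the loop hypothesis
  puts \<open>p\<close> into its own class, which turns equality of classes back into a
  homotopy.\<close>

lemma path_class_eq_iff:
  assumes "p \<in> loops_at S x"
  shows "path_class S p = path_class S q \<longleftrightarrow> homotopic_paths S p q"
proof
  assume "path_class S p = path_class S q"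
  moreover have "p \<in> path_class S p"
    using assms by (simp add: path_class_def loops_at_def)
  ultimately show "homotopic_paths S p q"
    by (auto simp: path_class_def intro: homotopic_paths_sym)
qed (rule path_class_eqI)

lemma carrier_fundamental_group:
  "carrier (fundamental_group S x) = path_class S ` loops_at S x"
  by (auto simp: fundamental_group_def path_class_def)

lemma one_fundamental_group: "\<one>\<^bsub>fundamental_group S x\<^esub> = path_class S (\<lambda>t. x)"
  by (simp add: fundamental_group_def path_class_def)

text \<open>Joining respects homotopy, so a single pair of representatives computes the product,
  which is defined through all of them.\<close>

lemma mult_fundamental_group:
  assumes "p \<in> loops_at S x" "q \<in> loops_at S x"
  shows "path_class S p \<otimes>\<^bsub>fundamental_group S x\<^esub> path_class S q = path_class S (p +++ q)"
proof -
  have "homotopic_paths S (p' +++ q') (p +++ q)"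
    if "homotopic_paths S p p'" "homotopic_paths S q q'" for p' q'
    by (rule homotopic_paths_sym, rule homotopic_paths_join)
       (use that assms in \<open>auto simp: loops_at_def\<close>)
  moreover have "homotopic_paths S p p" "homotopic_paths S q q"
    using assms by (auto simp: loops_at_def)
  ultimately have "(\<exists>p'\<in>path_class S p. \<exists>q'\<in>path_class S q. homotopic_paths S (p' +++ q') r) \<longleftrightarrow>
      homotopic_paths S (p +++ q) r" for r
    unfolding path_class_def using homotopic_paths_trans homotopic_paths_sym by blast
  then show ?thesis
    by (simp add: fundamental_group_def path_class_def)
qed

lemma join_in_loops_at:
  assumes "p \<in> loops_at S x" "q \<in> loops_at S x"
  shows "p +++ q \<in> loops_at S x"
  using assms by (auto simp: loops_at_def path_image_join)

lemma const_in_loops_at: "x \<in> S \<Longrightarrow> (\<lambda>t. x) \<in> loops_at S x"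
  by (auto simp: loops_at_def path_def path_image_def pathstart_def pathfinish_def)

lemma reversepath_in_loops_at: "p \<in> loops_at S x \<Longrightarrow> reversepath p \<in> loops_at S x"
  by (auto simp: loops_at_def)

lemma compose_in_loops_at:
  assumes "p \<in> loops_at S x" "continuous_on S f" "f ` S \<subseteq> T"
  shows "f \<circ> p \<in> loops_at T (f x)"
proof -
  have "path (f \<circ> p)"
    using assms by (intro path_continuous_image) (auto simp: loops_at_def elim: continuous_on_subset)
  with assms show ?thesis
    by (auto simp: loops_at_def path_image_compose pathstart_compose pathfinish_compose)
qed

text \<open>In an arbitrary space the unit and inverse laws are the images, under the path itself, of
  the corresponding laws for linear paths in the interval.\<close>

lemma homotopic_paths_const_left:
  fixes p :: "real \<Rightarrow> 'a::topological_space"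
  assumes "path p" "path_image p \<subseteq> S"
  shows "homotopic_paths S ((\<lambda>t. pathstart p) +++ p) p"
proof -
  have "homotopic_paths {0..1} (linepath 0 0 +++ linepath 0 1) (linepath 0 (1::real))"
    by (rule homotopic_paths_lid') (auto simp: path_image_linepath closed_segment_eq_real_ivl)
  from homotopic_paths_continuous_image [OF this, of p S]
  have "homotopic_paths S (p \<circ> (linepath 0 0 +++ linepath 0 1)) (p \<circ> linepath 0 1)"
    using assms by (auto simp: path_def path_image_def)
  also have "p \<circ> (linepath 0 0 +++ linepath 0 1) = (\<lambda>t. pathstart p) +++ p"
    by (auto simp: joinpaths_def linepath_def pathstart_def)
  also have "p \<circ> linepath 0 1 = p"
    by (auto simp: linepath_def)
  finally show ?thesis .
qed

lemma homotopic_paths_const_right: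
  fixes p :: "real \<Rightarrow> 'a::topological_space"
  assumes "path p" "path_image p \<subseteq> S"
  shows "homotopic_paths S (p +++ (\<lambda>t. pathfinish p)) p"
proof -
  have "homotopic_paths {0..1} (linepath 0 1 +++ linepath 1 1) (linepath 0 (1::real))"
    by (rule homotopic_paths_rid') (auto simp: path_image_linepath closed_segment_eq_real_ivl)
  from homotopic_paths_continuous_image [OF this, of p S]
  have "homotopic_paths S (p \<circ> (linepath 0 1 +++ linepath 1 1)) (p \<circ> linepath 0 1)"
    using assms by (auto simp: path_def path_image_def)
  also have "p \<circ> (linepath 0 1 +++ linepath 1 1) = p +++ (\<lambda>t. pathfinish p)"
    by (auto simp: joinpaths_def linepath_def pathfinish_def)
  also have "p \<circ> linepath 0 1 = p"
    by (auto simp: linepath_def)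
  finally show ?thesis .
qed

lemma homotopic_paths_reversepath_right:
  fixes p :: "real \<Rightarrow> 'a::topological_space"
  assumes "path p" "path_image p \<subseteq> S"
  shows "homotopic_paths S (p +++ reversepath p) (\<lambda>t. pathstart p)"
proof -
  have "homotopic_paths {0..1} (linepath 0 1 +++ reversepath (linepath 0 1))
      (linepath (pathstart (linepath 0 1)) (pathstart (linepath 0 (1::real))))"
    by (rule homotopic_paths_rinv) (auto simp: path_image_linepath closed_segment_eq_real_ivl)
  from homotopic_paths_continuous_image [OF this, of p S]
  have "homotopic_paths S (p \<circ> (linepath 0 1 +++ reversepath (linepath 0 1))) (p \<circ> linepath 0 0)"
    using assms by (auto simp: path_def path_image_def)
  also have "p \<circ> (linepath 0 1 +++ reversepath (linepath 0 1)) = p +++ reversepath p"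
    by (auto simp: joinpaths_def linepath_def reversepath_def)
  also have "p \<circ> linepath 0 0 = (\<lambda>t. pathstart p)"
    by (auto simp: linepath_def pathstart_def)
  finally show ?thesis .
qed

lemma homotopic_paths_reversepath_left:
  fixes p :: "real \<Rightarrow> 'a::topological_space"
  assumes "path p" "path_image p \<subseteq> S"
  shows "homotopic_paths S (reversepath p +++ p) (\<lambda>t. pathfinish p)"
  using homotopic_paths_reversepath_right [of "reversepath p" S] assms by simp

section \<open>Cancellation of paths and change of base point\<close>

lemma homotopic_paths_cancel_right:
  fixes p :: "real \<Rightarrow> 'a::topological_space"
  assumes "path p" "path_image p \<subseteq> S" "path g" "path_image g \<subseteq> S" "pathfinish p = pathstart g"
  shows "homotopic_paths S ((p +++ g) +++ reversepath g) p"
proof -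
  have "homotopic_paths S ((p +++ g) +++ reversepath g) (p +++ (g +++ reversepath g))"
    by (rule homotopic_paths_sym, rule homotopic_paths_assoc) (use assms in auto)
  also have "homotopic_paths S (p +++ (g +++ reversepath g)) (p +++ (\<lambda>t. pathfinish p))"
    using assms by (intro homotopic_paths_join) (auto simp: homotopic_paths_reversepath_right)
  also have "homotopic_paths S (p +++ (\<lambda>t. pathfinish p)) p"
    using assms by (intro homotopic_paths_const_right)
  finally show ?thesis .
qed

lemma homotopic_paths_cancel_left:
  fixes p :: "real \<Rightarrow> 'a::topological_space"
  assumes "path p" "path_image p \<subseteq> S" "path g" "path_image g \<subseteq> S" "pathfinish g = pathstart p"
  shows "homotopic_paths S (reversepath g +++ (g +++ p)) p"
proof -
  have "homotopic_paths S (reversepath g +++ (g +++ p)) ((reversepath g +++ g) +++ p)"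
    by (rule homotopic_paths_assoc) (use assms in auto)
  also have "homotopic_paths S ((reversepath g +++ g) +++ p) ((\<lambda>t. pathstart p) +++ p)"
    using assms homotopic_paths_reversepath_left [of g S] by (intro homotopic_paths_join) auto
  also have "homotopic_paths S ((\<lambda>t. pathstart p) +++ p) p"
    using assms by (intro homotopic_paths_const_left)
  finally show ?thesis .
qed

lemma group_fundamental_group:
  assumes "x \<in> S"
  shows "group (fundamental_group S x)"
proof (rule groupI)
  let ?G = "fundamental_group S x"
  show "\<one>\<^bsub>?G\<^esub> \<in> carrier ?G"
    using assms by (simp add: one_fundamental_group carrier_fundamental_group const_in_loops_at)
  fix A assume "A \<in> carrier ?G"
  then obtain p where p: "p \<in> loops_at S x" "A = path_class S p"
    by (auto simp: carrier_fundamental_group)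
  show "\<one>\<^bsub>?G\<^esub> \<otimes>\<^bsub>?G\<^esub> A = A"
    using p assms homotopic_paths_const_left [of p S]
    by (simp add: one_fundamental_group mult_fundamental_group const_in_loops_at)
       (auto intro!: path_class_eqI simp: loops_at_def)
  have "path_class S (reversepath p) \<otimes>\<^bsub>?G\<^esub> A = path_class S (\<lambda>t. x)"
    using p homotopic_paths_reversepath_left [of p S]
    by (simp add: mult_fundamental_group reversepath_in_loops_at)
       (auto intro!: path_class_eqI simp: loops_at_def)
  then show "\<exists>B\<in>carrier ?G. B \<otimes>\<^bsub>?G\<^esub> A = \<one>\<^bsub>?G\<^esub>"
    using p by (auto simp: carrier_fundamental_group one_fundamental_group
        intro!: bexI [of _ "path_class S (reversepath p)"] reversepath_in_loops_at)
  fix B assume "B \<in> carrier ?G"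
  then obtain q where q: "q \<in> loops_at S x" "B = path_class S q"
    by (auto simp: carrier_fundamental_group)
  show "A \<otimes>\<^bsub>?G\<^esub> B \<in> carrier ?G"
    using p q by (simp add: mult_fundamental_group carrier_fundamental_group join_in_loops_at)
  fix C assume "C \<in> carrier ?G"
  then obtain r where r: "r \<in> loops_at S x" "C = path_class S r"
    by (auto simp: carrier_fundamental_group)
  have "homotopic_paths S (p +++ (q +++ r)) ((p +++ q) +++ r)"
    using p q r by (intro homotopic_paths_assoc) (auto simp: loops_at_def)
  with p q r show "A \<otimes>\<^bsub>?G\<^esub> B \<otimes>\<^bsub>?G\<^esub> C = A \<otimes>\<^bsub>?G\<^esub> (B \<otimes>\<^bsub>?G\<^esub> C)"
    by (simp add: mult_fundamental_group join_in_loops_at path_class_eqI)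
qed

text \<open>Conjugation by a path \<open>g\<close> from \<open>x\<close> to \<open>y\<close>.
  Cancelling \<open>g\<close> on both sides gives injectivity; conjugating a loop at
  \<open>y\<close> backwards gives a preimage.\<close>

lemma fundamental_group_iso_basepoint:
  fixes S :: "'a::topological_space set"
  assumes "path_connected S" "x \<in> S" "y \<in> S"
  shows "fundamental_group S x \<cong> fundamental_group S y"
proof -
  obtain g where g: "path g" "path_image g \<subseteq> S" "pathstart g = x" "pathfinish g = y"
    using assms unfolding path_connected_def by blast
  define c where "c p = reversepath g +++ (p +++ g)" for p
  have c_loop: "c p \<in> loops_at S y" if "p \<in> loops_at S x" for p
    using that g by (auto simp: c_def loops_at_def path_image_join)
  have c_homotopic: "homotopic_paths S (c p) (c q)"
    if "p \<in> loops_at S x" "homotopic_paths S p q" for p q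
    using that g unfolding c_def by (intro homotopic_paths_join) (auto simp: loops_at_def)
  \<comment> \<open>A class comes without a distinguished loop, so one is chosen;
    \<open>c_homotopic\<close> makes the value independent of the choice.\<close>
  define h where "h A = path_class S (c (SOME p. p \<in> loops_at S x \<and> A = path_class S p))" for A
  have h: "h (path_class S p) = path_class S (c p)" if p: "p \<in> loops_at S x" for p
  proof -
    define p' where "p' = (SOME r. r \<in> loops_at S x \<and> path_class S p = path_class S r)"
    have "p' \<in> loops_at S x \<and> path_class S p = path_class S p'"
      unfolding p'_def by (rule someI [of _ p]) (use p in simp)
    then have "homotopic_paths S (c p) (c p')"
      using p path_class_eq_iff c_homotopic by blast
    then show ?thesis
      unfolding h_def p'_def by (metis path_class_eqI)
  qed
  \<comment> \<open>The detour \<open>g +++ reversepath g\<close> is inserted between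
    \<open>p\<close> and \<open>q\<close>, which breaks the conjugate of the join into a join of
    conjugates.\<close>
  have c_join: "homotopic_paths S (c (p +++ q)) (c p +++ c q)"
    if "p \<in> loops_at S x" "q \<in> loops_at S x" for p q
  proof -
    note pq = that [unfolded loops_at_def, simplified]
    have "homotopic_paths S (p +++ (q +++ g)) (((p +++ g) +++ reversepath g) +++ (q +++ g))"
      using pq g by (intro homotopic_paths_join homotopic_paths_sym [OF homotopic_paths_cancel_right])
          (auto simp: path_image_join)
    also have "homotopic_paths S (((p +++ g) +++ reversepath g) +++ (q +++ g)) ((p +++ g) +++ c q)"
      unfolding c_def using pq g
      by (intro homotopic_paths_sym [OF homotopic_paths_assoc]) (auto simp: path_image_join)
    finally have "homotopic_paths S (p +++ (q +++ g)) ((p +++ g) +++ c q)" .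
    then have 1: "homotopic_paths S ((p +++ q) +++ g) ((p +++ g) +++ c q)"
      using pq g
      by (intro homotopic_paths_trans [OF homotopic_paths_sym [OF homotopic_paths_assoc]]) auto
    have "homotopic_paths S (c (p +++ q)) (reversepath g +++ ((p +++ g) +++ c q))"
      using pq g unfolding c_def [of "p +++ q"] by (intro homotopic_paths_join [OF _ 1]) auto
    also have "homotopic_paths S (reversepath g +++ ((p +++ g) +++ c q)) (c p +++ c q)"
      using pq g c_loop [OF that(2)] unfolding c_def [of p]
      by (intro homotopic_paths_assoc) (auto simp: path_image_join loops_at_def)
    finally show ?thesis .
  qed
  have "h \<in> iso (fundamental_group S x) (fundamental_group S y)"
  proof (rule isoI)
    show "h \<in> hom (fundamental_group S x) (fundamental_group S y)"
    proof (rule homI)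
      show "h A \<in> carrier (fundamental_group S y)" if "A \<in> carrier (fundamental_group S x)" for A
        using that by (auto simp: carrier_fundamental_group h c_loop)
      show "h (A \<otimes>\<^bsub>fundamental_group S x\<^esub> B) = h A \<otimes>\<^bsub>fundamental_group S y\<^esub> h B"
        if AB: "A \<in> carrier (fundamental_group S x)" "B \<in> carrier (fundamental_group S x)" for A B
      proof -
        obtain p q where "p \<in> loops_at S x" "A = path_class S p" "q \<in> loops_at S x" "B = path_class S q"
          using AB by (auto simp: carrier_fundamental_group)
        then show ?thesis
          by (simp add: h c_loop mult_fundamental_group join_in_loops_at path_class_eqI [OF c_join])
      qed
    qed
    show "bij_betw h (carrier (fundamental_group S x)) (carrier (fundamental_group S y))"
      unfolding bij_betw_def
    proof
      show "inj_on h (carrier (fundamental_group S x))"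
      proof (rule inj_onI)
        fix A B assume "A \<in> carrier (fundamental_group S x)" "B \<in> carrier (fundamental_group S x)"
          and eq: "h A = h B"
        then obtain p q where p: "p \<in> loops_at S x" "A = path_class S p"
          and q: "q \<in> loops_at S x" "B = path_class S q"
          by (auto simp: carrier_fundamental_group)
        note pq = p(1) [unfolded loops_at_def, simplified] q(1) [unfolded loops_at_def, simplified]
        have "homotopic_paths S (c p) (c q)"
          using eq p q c_loop by (metis h path_class_eq_iff)
        then have 1: "homotopic_paths S (g +++ c p) (g +++ c q)"
          using g pq by (intro homotopic_paths_join) (auto simp: c_def)
        have 2: "homotopic_paths S (g +++ c r) (r +++ g)" if "r \<in> loops_at S x" for r
        proof -
          have "homotopic_paths S (reversepath (reversepath g) +++ (reversepath g +++ (r +++ g))) (r +++ g)"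
            by (rule homotopic_paths_cancel_left) (use that g in \<open>auto simp: loops_at_def path_image_join\<close>)
          then show ?thesis
            by (simp only: c_def reversepath_reversepath)
        qed
        have pg: "homotopic_paths S (p +++ g) (q +++ g)"
          by (rule homotopic_paths_trans [OF homotopic_paths_sym [OF 2 [OF p(1)]]
                homotopic_paths_trans [OF 1 2 [OF q(1)]]])
        have 3: "homotopic_paths S ((p +++ g) +++ reversepath g) ((q +++ g) +++ reversepath g)"
          using g by (intro homotopic_paths_join [OF pg]) auto
        have 4: "homotopic_paths S ((r +++ g) +++ reversepath g) r" if "r \<in> loops_at S x" for r
          by (rule homotopic_paths_cancel_right) (use that g in \<open>auto simp: loops_at_def\<close>)
        have "homotopic_paths S p q"
          by (rule homotopic_paths_trans [OF homotopic_paths_sym [OF 4 [OF p(1)]]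
                homotopic_paths_trans [OF 3 4 [OF q(1)]]])
        then show "A = B"
          using p q by (simp add: path_class_eqI)
      qed
      show "h ` carrier (fundamental_group S x) = carrier (fundamental_group S y)"
      proof
        show "h ` carrier (fundamental_group S x) \<subseteq> carrier (fundamental_group S y)"
          by (auto simp: carrier_fundamental_group h c_loop)
        show "carrier (fundamental_group S y) \<subseteq> h ` carrier (fundamental_group S x)"
        proof
          fix B assume "B \<in> carrier (fundamental_group S y)"
          then obtain q where q: "q \<in> loops_at S y" "B = path_class S q"
            by (auto simp: carrier_fundamental_group)
          note q' = q(1) [unfolded loops_at_def, simplified]
          define p where "p = g +++ (q +++ reversepath g)"
          have p: "p \<in> loops_at S x"
            using q' g by (auto simp: p_def loops_at_def path_image_join)
          have "homotopic_paths S (p +++ g) (g +++ ((q +++ reversepath g) +++ g))"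
            unfolding p_def using q' g
            by (intro homotopic_paths_sym [OF homotopic_paths_assoc]) (auto simp: path_image_join)
          also have "homotopic_paths S (g +++ ((q +++ reversepath g) +++ g)) (g +++ q)"
            using q' g homotopic_paths_cancel_right [of q S "reversepath g"]
            by (intro homotopic_paths_join) auto
          finally have pg: "homotopic_paths S (p +++ g) (g +++ q)" .
          have "homotopic_paths S (c p) (reversepath g +++ (g +++ q))"
            using q' g unfolding c_def by (intro homotopic_paths_join [OF _ pg]) (auto simp: p_def)
          also have "homotopic_paths S (reversepath g +++ (g +++ q)) q"
            by (rule homotopic_paths_cancel_left) (use q' g in auto)
          finally have "h (path_class S p) = B"
            using p q by (simp add: h path_class_eqI)
          with p show "B \<in> h ` carrier (fundamental_group S x)"
            by (auto simp: carrier_fundamental_group)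
        qed
      qed
    qed
  qed
  then show ?thesis
    by (rule is_isoI)
qed

text \<open>The maps \<open>F i\<close> split \<open>S\<close> as a product, with inverse \<open>G\<close>. Coordinates outside \<open>I\<close> of an
  argument of \<open>G\<close> are irrelevant, so no extensionality condition is needed.\<close>

lemma fundamental_group_iso_product:
  fixes S :: "'a::topological_space set" and T :: "'i \<Rightarrow> 'b::topological_space set"
  assumes F_cont: "\<And>i. i \<in> I \<Longrightarrow> continuous_on S (F i)"
    and F_in: "\<And>i. i \<in> I \<Longrightarrow> F i ` S \<subseteq> T i"
    and G_cont: "continuous_on {c. \<forall>i\<in>I. c i \<in> T i} G"
    and G_in: "G ` {c. \<forall>i\<in>I. c i \<in> T i} \<subseteq> S"
    and GF: "\<And>a c. a \<in> S \<Longrightarrow> (\<And>i. i \<in> I \<Longrightarrow> c i = F i a) \<Longrightarrow> G c = a"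
    and FG: "\<And>c i. i \<in> I \<Longrightarrow> (\<And>i. i \<in> I \<Longrightarrow> c i \<in> T i) \<Longrightarrow> F i (G c) = c i"
    and x: "x \<in> S"
  shows "fundamental_group S x \<cong> product_group I (\<lambda>i. fundamental_group (T i) (F i x))"
proof -
  let ?\<pi> = "fundamental_group S x" and ?P = "product_group I (\<lambda>i. fundamental_group (T i) (F i x))"
  define h where
    "h A = (\<lambda>i\<in>I. path_class (T i) (F i \<circ> (SOME p. p \<in> loops_at S x \<and> A = path_class S p)))" for A
  have h: "h (path_class S p) = (\<lambda>i\<in>I. path_class (T i) (F i \<circ> p))" if p: "p \<in> loops_at S x" for p
  proof -
    define p' where "p' = (SOME r. r \<in> loops_at S x \<and> path_class S p = path_class S r)"
    have "p' \<in> loops_at S x \<and> path_class S p = path_class S p'"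
      unfolding p'_def by (rule someI [of _ p]) (use p in simp)
    then have "homotopic_paths S p p'"
      using p path_class_eq_iff by blast
    then have "homotopic_paths (T i) (F i \<circ> p) (F i \<circ> p')" if "i \<in> I" for i
      using that F_cont F_in by (intro homotopic_paths_continuous_image) auto
    then show ?thesis
      unfolding h_def p'_def by (intro restrict_ext) (metis path_class_eqI)
  qed
  have F_loop: "F i \<circ> p \<in> loops_at (T i) (F i x)" if "i \<in> I" "p \<in> loops_at S x" for i p
    using that F_cont F_in by (intro compose_in_loops_at) auto
  have "h \<in> iso ?\<pi> ?P"
  proof (rule isoI)
    show "h \<in> hom ?\<pi> ?P"
    proof (rule homI)
      show "h A \<in> carrier ?P" if "A \<in> carrier ?\<pi>" for A
        using that F_loop by (auto simp: carrier_fundamental_group h)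
      show "h (A \<otimes>\<^bsub>?\<pi>\<^esub> B) = h A \<otimes>\<^bsub>?P\<^esub> h B" if "A \<in> carrier ?\<pi>" "B \<in> carrier ?\<pi>" for A B
        using that F_loop
        by (auto simp: carrier_fundamental_group h mult_fundamental_group join_in_loops_at
            path_compose_join intro!: restrict_ext)
    qed
    show "bij_betw h (carrier ?\<pi>) (carrier ?P)"
      unfolding bij_betw_def
    proof
      show "inj_on h (carrier ?\<pi>)"
      proof (rule inj_onI)
        fix A B assume "A \<in> carrier ?\<pi>" "B \<in> carrier ?\<pi>" and eq: "h A = h B"
        then obtain p q where p: "p \<in> loops_at S x" "A = path_class S p"
          and q: "q \<in> loops_at S x" "B = path_class S q"
          by (auto simp: carrier_fundamental_group)
        have "homotopic_paths (T i) (F i \<circ> p) (F i \<circ> q)" if i: "i \<in> I" for i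
        proof -
          have "path_class (T i) (F i \<circ> p) = path_class (T i) (F i \<circ> q)"
            using fun_cong [OF eq, of i] i p q by (simp add: h)
          then show ?thesis
            using path_class_eq_iff F_loop [OF i p(1)] by blast
        qed
        then have "\<forall>i\<in>I. \<exists>k. continuous_on ({0..1} \<times> {0..1}) k \<and> k \<in> ({0..1} \<times> {0..1}) \<rightarrow> T i \<and>
            (\<forall>t\<in>{0..1}. k (0,t) = F i (p t)) \<and> (\<forall>t\<in>{0..1}. k (1,t) = F i (q t)) \<and>
            (\<forall>t\<in>{0..1::real}. k (t,0) = F i (p 0) \<and> k (t,1) = F i (p 1))"
          unfolding homotopic_paths by (simp add: pathstart_def pathfinish_def)
        from bchoice [OF this]
        obtain k :: "'i \<Rightarrow> real \<times> real \<Rightarrow> 'b"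
          where k: "\<And>i. i \<in> I \<Longrightarrow> continuous_on ({0..1} \<times> {0..1}) (k i)"
            "\<And>i. i \<in> I \<Longrightarrow> k i \<in> ({0..1} \<times> {0..1}) \<rightarrow> T i"
            "\<And>i t. i \<in> I \<Longrightarrow> t \<in> {0..1} \<Longrightarrow> k i (0,t) = F i (p t)"
            "\<And>i t. i \<in> I \<Longrightarrow> t \<in> {0..1} \<Longrightarrow> k i (1,t) = F i (q t)"
            "\<And>i t. i \<in> I \<Longrightarrow> t \<in> {0..1} \<Longrightarrow> k i (t,0) = F i (p 0) \<and> k i (t,1) = F i (p 1)"
          by blast
        \<comment> \<open>The homotopies chosen for the single coordinates become one map into the
          product, which \<open>G\<close> carries back to \<open>S\<close>. Outside \<open>I\<close>
          the map is constant, hence continuous in those coordinates too.\<close>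
        define K where "K y = (\<lambda>i. if i \<in> I then k i y else undefined)" for y
        have K_cont: "continuous_on ({0..1} \<times> {0..1}) K"
          unfolding K_def
        proof (rule continuous_on_coordinatewise_then_product)
          show "continuous_on ({0..1} \<times> {0..1}) (\<lambda>y. if i \<in> I then k i y else undefined)" for i
            using k(1) by (cases "i \<in> I") auto
        qed
        have K_in: "K ` ({0..1} \<times> {0..1}) \<subseteq> {c. \<forall>i\<in>I. c i \<in> T i}"
          using k(2) by (fastforce simp: K_def)
        have pq: "p t \<in> S" "q t \<in> S" if "t \<in> {0..1}" for t
          using that p q by (auto simp: loops_at_def path_image_def)
        have "homotopic_paths S p q"
          unfolding homotopic_paths
        proof (intro exI conjI ballI)
          show "continuous_on ({0..1} \<times> {0..1}) (G \<circ> K)"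
            using K_cont K_in G_cont by (blast intro: continuous_on_compose continuous_on_subset)
          show "G \<circ> K \<in> {0..1} \<times> {0..1} \<rightarrow> S"
            using K_in G_in by fastforce
          show "(G \<circ> K) (0, t) = p t" if "t \<in> {0..1}" for t
            using that pq k(3) by (auto simp: K_def intro!: GF)
          show "(G \<circ> K) (1, t) = q t" if "t \<in> {0..1}" for t
            using that pq k(4) by (auto simp: K_def intro!: GF)
          show "pathstart (G \<circ> K \<circ> Pair t) = pathstart p" if "t \<in> {0..1}" for t
            using that pq k(5) by (auto simp: K_def pathstart_def intro!: GF)
          show "pathfinish (G \<circ> K \<circ> Pair t) = pathfinish p" if "t \<in> {0..1}" for t
            using that pq k(5) by (auto simp: K_def pathfinish_def intro!: GF)
        qed
        then show "A = B"
          using p q by (simp add: path_class_eqI)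
      qed
      show "h ` carrier ?\<pi> = carrier ?P"
      proof
        show "h ` carrier ?\<pi> \<subseteq> carrier ?P"
          using F_loop by (auto simp: carrier_fundamental_group h)
        show "carrier ?P \<subseteq> h ` carrier ?\<pi>"
        proof
          fix B assume B: "B \<in> carrier ?P"
          then have "\<forall>i\<in>I. \<exists>p. p \<in> loops_at (T i) (F i x) \<and> B i = path_class (T i) p"
            by (auto simp: carrier_fundamental_group PiE_iff)
          then obtain p where p: "\<And>i. i \<in> I \<Longrightarrow> p i \<in> loops_at (T i) (F i x)"
              "\<And>i. i \<in> I \<Longrightarrow> B i = path_class (T i) (p i)"
            by metis
          define K where "K t = (\<lambda>i. if i \<in> I then p i t else undefined)" for t
          have K_cont: "continuous_on {0..1} K"
            unfolding K_def
          proof (rule continuous_on_coordinatewise_then_product)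
            show "continuous_on {0..1} (\<lambda>t. if i \<in> I then p i t else undefined)" for i
              using p(1) by (cases "i \<in> I") (auto simp: loops_at_def path_def)
          qed
          have K_in: "K ` {0..1} \<subseteq> {c. \<forall>i\<in>I. c i \<in> T i}"
            using p(1) by (fastforce simp: K_def loops_at_def path_image_def)
          have "continuous_on {0..1} (G \<circ> K)"
            using K_cont K_in G_cont by (blast intro: continuous_on_compose continuous_on_subset)
          moreover have "G (K 0) = x" "G (K 1) = x"
            using p(1) x by (auto intro!: GF simp: K_def loops_at_def pathstart_def pathfinish_def)
          ultimately have loop: "G \<circ> K \<in> loops_at S x"
            using K_in G_in
            by (fastforce simp: loops_at_def path_def path_image_def pathstart_def pathfinish_def)
          have "path_class (T i) (F i \<circ> (G \<circ> K)) = B i" if i: "i \<in> I" for i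
          proof -
            have "homotopic_paths (T i) (F i \<circ> (G \<circ> K)) (p i)"
            proof (rule homotopic_paths_eq)
              show "(F i \<circ> (G \<circ> K)) t = p i t" if "t \<in> {0..1}" for t
              proof -
                have "K t i' \<in> T i'" if "i' \<in> I" for i'
                  using \<open>t \<in> {0..1}\<close> K_in that by blast
                then show ?thesis
                  using FG [OF i, of "K t"] i by (simp add: K_def)
              qed
            qed (use F_loop [OF i loop] in \<open>auto simp: loops_at_def\<close>)
            then show ?thesis
              using p i by (simp add: path_class_eqI)
          qed
          then have "h (path_class S (G \<circ> K)) = B"
            using B loop by (intro ext) (simp add: h PiE_iff extensional_def)
          with loop show "B \<in> h ` carrier ?\<pi>"
            by (auto simp: carrier_fundamental_group)
        qed
      qed
    qed
  qed
  then show ?thesis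
    by (rule is_isoI)
qed

text \<open>A homeomorphism is a splitting with one factor, so the product lemma applies over a
  one-point index set; evaluation at that point removes the product.\<close>

lemma fundamental_group_iso_homeomorphism:
  fixes S :: "'a::topological_space set" and T :: "'b::topological_space set"
  assumes f: "homeomorphism S T f g" and x: "x \<in> S"
  shows "fundamental_group S x \<cong> fundamental_group T (f x)"
proof -
  let ?P = "product_group {()} (\<lambda>_. fundamental_group T (f x))"
  have "fundamental_group S x \<cong> ?P"
  proof (rule fundamental_group_iso_product
      [where F = "\<lambda>_. f" and G = "\<lambda>c. g (c ())" and T = "\<lambda>_. T"])
    have "continuous_on {c. \<forall>i\<in>{()}. c i \<in> T} (\<lambda>c. c ())"
      by (rule continuous_on_product_then_coordinatewise) (rule continuous_on_id)
    then show "continuous_on {c. \<forall>i\<in>{()}. c i \<in> T} (\<lambda>c. g (c ()))"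
      by (rule continuous_on_compose2 [of T g, rotated]) (use f in \<open>auto simp: homeomorphism_def\<close>)
  qed (use f x in \<open>auto simp: homeomorphism_def image_subset_iff\<close>)
  moreover have "(\<lambda>c. c ()) \<in> iso ?P (fundamental_group T (f x))"
  proof (rule isoI)
    show "bij_betw (\<lambda>c. c ()) (carrier ?P) (carrier (fundamental_group T (f x)))"
      by (rule bij_betwI [of _ _ _ "\<lambda>a _. a"]) auto
    show "(\<lambda>c. c ()) \<in> hom ?P (fundamental_group T (f x))"
      by (rule homI) auto
  qed
  ultimately show ?thesis
    using is_isoI iso_trans by blast
qed

section \<open>Exponential factors\<close>

lemma denom_pos: "0 < denom k"
  using quotient_of_denom_pos' [of k] by (simp add: denom_def)

text \<open>Numerator and denominator are coprime. This turns the integrality conditions in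
  \<open>ram\<close> into divisibility by \<open>denom\<close>, the form used from here on.\<close>

lemma mult_in_Ints_iff_denom_dvd: "of_nat n * k \<in> \<int> \<longleftrightarrow> denom k dvd n"
proof -
  obtain a b where ab: "quotient_of k = (a, b)"
    by fastforce
  have b: "0 < b" and k: "k = of_int a / of_int b" and cop: "coprime a b"
    using ab quotient_of_denom_pos quotient_of_div quotient_of_coprime by auto
  have "of_nat n * k \<in> \<int> \<longleftrightarrow> b dvd int n * a"
  proof
    assume "of_nat n * k \<in> \<int>"
    then obtain c where "of_nat n * k = of_int c"
      by (auto elim: Ints_cases)
    then have "(of_int (int n * a) :: rat) = of_int (b * c)"
      using b k by (simp add: field_simps)
    then show "b dvd int n * a"
      by (metis of_int_eq_iff dvd_triv_left)
  next
    assume "b dvd int n * a"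
    then obtain c where "int n * a = b * c" ..
    then have "(of_int (int n * a) :: rat) = of_int (b * c)"
      by simp
    then have "of_nat n * of_int a / of_int b = (of_int c :: rat)"
      using b by (simp add: field_simps)
    then have "of_nat n * k = of_int c"
      by (simp add: k)
    then show "of_nat n * k \<in> \<int>"
      by simp
  qed
  also have "\<dots> \<longleftrightarrow> b dvd int n"
    using cop by (simp add: coprime_dvd_mult_left_iff coprime_commute)
  also have "\<dots> \<longleftrightarrow> denom k dvd n"
    using b ab by (simp add: denom_def flip: int_dvd_int_iff)
  finally show ?thesis .
qed

lemma eq_divide_of_nat_iff_denom_dvd:
  assumes "0 < x" "0 < n"
  shows "(\<exists>j::nat. x = of_nat j / of_nat n) \<longleftrightarrow> denom x dvd n"
proof
  assume "\<exists>j::nat. x = of_nat j / of_nat n"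
  then obtain j :: nat where "x = of_nat j / of_nat n" ..
  then have "of_nat n * x = of_nat j"
    using assms by simp
  then show "denom x dvd n"
    by (metis Ints_of_nat mult_in_Ints_iff_denom_dvd)
next
  assume "denom x dvd n"
  then obtain c where c: "of_nat n * x = of_int c"
    by (auto simp flip: mult_in_Ints_iff_denom_dvd elim: Ints_cases)
  moreover have "0 < of_nat n * x"
    using assms by simp
  ultimately have "x = of_nat (nat c) / of_nat n"
    using assms by (simp add: field_simps)
  then show "\<exists>j::nat. x = of_nat j / of_nat n" ..
qed

text \<open>The factor by which \<open>gal\<close> multiplies the coefficient at exponent
  \<open>k\<close>; by \<open>zeta_power_eq_1_iff\<close> it is a root of unity of exact order
  \<open>denom k\<close>.\<close>

definition zeta :: "rat \<Rightarrow> complex" where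
  "zeta k = cis (- 2 * pi * of_rat k)"

lemma zeta_nonzero [simp]: "zeta k \<noteq> 0"
  by (simp add: zeta_def)

lemma zeta_power_eq_1_iff: "zeta k ^ n = 1 \<longleftrightarrow> denom k dvd n"
proof -
  have "zeta k ^ n = 1 \<longleftrightarrow> (\<exists>c::int. real n * (- 2 * pi * of_rat k) = of_int c * (2 * pi))"
    unfolding zeta_def Complex.DeMoivre cis_eq_1_iff ..
  also have "\<dots> \<longleftrightarrow> (\<exists>c::int. real n * of_rat k = - of_int c)"
  proof (intro ex_cong1)
    fix c :: int
    have "real n * (- 2 * pi * of_rat k) = of_int c * (2 * pi) \<longleftrightarrow>
        (2 * pi) * (real n * of_rat k) = (2 * pi) * - of_int c"
      by (simp add: algebra_simps) linarith
    then show "real n * (- 2 * pi * of_rat k) = of_int c * (2 * pi) \<longleftrightarrow> real n * of_rat k = - of_int c"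
      by (simp only: mult_cancel_left) simp
  qed
  also have "\<dots> \<longleftrightarrow> (\<exists>c::int. of_nat n * k = - of_int c)"
  proof (intro ex_cong1)
    fix c :: int
    have "real n * of_rat k = of_rat (of_nat n * k)"
      by (simp add: of_rat_mult)
    moreover have "- of_int c = (of_rat (- of_int c) :: real)"
      by (simp add: of_rat_minus)
    ultimately show "(real n * of_rat k = - of_int c) = (of_nat n * k = - of_int c)"
      by (simp only: of_rat_eq_iff)
  qed
  also have "\<dots> \<longleftrightarrow> of_nat n * k \<in> \<int>"
    by (metis Ints_cases Ints_minus Ints_of_int minus_minus of_int_minus)
  finally show ?thesis
    by (simp add: mult_in_Ints_iff_denom_dvd)
qed

lemma zeta_power_eq_iff: "zeta k ^ m = zeta k ^ n \<longleftrightarrow> int (denom k) dvd int m - int n"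
proof (induction m n rule: linorder_wlog)
  case (le m n)
  have "zeta k ^ n = zeta k ^ m * zeta k ^ (n - m)"
    using le by (simp flip: power_add)
  then have "zeta k ^ m = zeta k ^ n \<longleftrightarrow> zeta k ^ (n - m) = 1"
    by auto
  also have "\<dots> \<longleftrightarrow> int (denom k) dvd int n - int m"
    using le by (simp add: zeta_power_eq_1_iff flip: int_dvd_int_iff)
  finally show ?case
    by (simp add: dvd_diff_commute)
next
  case (sym m n)
  then show ?case
    by (metis dvd_diff_commute)
qed

lemma gal_funpow: "(gal ^^ i) q k = q k * zeta k ^ i"
  by (induction i) (simp_all add: gal_def zeta_def)

section \<open>Truncations, ramification and Galois orbits\<close>

text \<open>Describes the parent of the node at height \<open>k\<close> without naming the parent's
  height: \<open>covers_strict_trunc\<close> identifies it with \<open>trunc\<close> at the next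
  larger height.\<close>

definition strict_trunc :: "rat \<Rightarrow> ef \<Rightarrow> ef" where
  "strict_trunc k q = (\<lambda>k'. if k < k' then q k' else 0)"

lemma trunc_apply: "trunc k q x = (if k \<le> x then q x else 0)"
  by (simp add: trunc_def)

lemma strict_trunc_apply: "strict_trunc k q x = (if k < x then q x else 0)"
  by (simp add: strict_trunc_def)

lemma is_ef_restrict:
  assumes "is_ef q"
  shows "is_ef (\<lambda>k. if P k then q k else 0)"
proof -
  have "finite {k. (if P k then q k else 0) \<noteq> 0}"
    by (rule finite_subset [of _ "{k. q k \<noteq> 0}"]) (use assms in \<open>auto simp: is_ef_def\<close>)
  then show ?thesis
    using assms unfolding is_ef_def by metis
qed

lemma is_ef_trunc: "is_ef q \<Longrightarrow> is_ef (trunc k q)"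
  unfolding trunc_def by (rule is_ef_restrict)

lemma is_ef_strict_trunc: "is_ef q \<Longrightarrow> is_ef (strict_trunc k q)"
  unfolding strict_trunc_def by (rule is_ef_restrict)

lemma is_ef_diff_gal:
  assumes "is_ef p" "is_ef q"
  shows "is_ef (\<lambda>x. (gal ^^ i) p x - (gal ^^ j) q x)"
  unfolding is_ef_def
proof
  have "{k. (gal ^^ i) p k - (gal ^^ j) q k \<noteq> 0} \<subseteq> {k. p k \<noteq> 0} \<union> {k. q k \<noteq> 0}"
    by (auto simp: gal_funpow)
  then show "finite {k. (gal ^^ i) p k - (gal ^^ j) q k \<noteq> 0}"
    using assms by (auto simp: is_ef_def elim: finite_subset)
  show "\<forall>k. (gal ^^ i) p k - (gal ^^ j) q k \<noteq> 0 \<longrightarrow> 0 < k"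
  proof (intro allI impI)
    fix k assume "(gal ^^ i) p k - (gal ^^ j) q k \<noteq> 0"
    then have "p k \<noteq> 0 \<or> q k \<noteq> 0"
      by (auto simp: gal_funpow)
    then show "0 < k"
      using assms by (auto simp: is_ef_def)
  qed
qed

text \<open>Finiteness of the support keeps the \<open>Lcm\<close> away from 0, so that it is itself
  a candidate for the least positive number in \<open>ram\<close>.\<close>

lemma ram_eq_Lcm:
  assumes "is_ef q"
  shows "ram q = Lcm (denom ` {k. q k \<noteq> 0})"
proof -
  let ?D = "denom ` {k. q k \<noteq> 0}"
  have "finite ?D" "0 \<notin> ?D"
    using assms denom_pos by (auto simp: is_ef_def) (metis less_irrefl)
  then have "Lcm ?D \<noteq> 0"
    by (simp add: Lcm_0_iff)
  then show ?thesis
    unfolding ram_def mult_in_Ints_iff_denom_dvd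
    by (intro Least_equality) (auto intro!: dvd_imp_le Lcm_least)
qed

lemma ram_dvd_iff: "is_ef q \<Longrightarrow> ram q dvd n \<longleftrightarrow> (\<forall>k. q k \<noteq> 0 \<longrightarrow> denom k dvd n)"
  by (simp add: ram_eq_Lcm Lcm_dvd_iff)

lemma ram_dvd_int_iff:
  assumes "is_ef q"
  shows "int (ram q) dvd n \<longleftrightarrow> (\<forall>k. q k \<noteq> 0 \<longrightarrow> int (denom k) dvd n)"
  using ram_dvd_iff [OF assms, of "nat \<bar>n\<bar>"] by (simp add: dvd_nat_abs_iff)

lemma ram_pos:
  assumes "is_ef q"
  shows "0 < ram q"
proof -
  have "finite (denom ` {k. q k \<noteq> 0})" "0 \<notin> denom ` {k. q k \<noteq> 0}"
    using assms denom_pos by (auto simp: is_ef_def) (metis less_irrefl)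
  then show ?thesis
    using assms by (simp add: ram_eq_Lcm Lcm_0_iff flip: neq0_conv)
qed

lemma denom_dvd_ram: "is_ef q \<Longrightarrow> q k \<noteq> 0 \<Longrightarrow> denom k dvd ram q"
  using ram_dvd_iff [of q "ram q"] by simp

lemma ram_trunc_dvd:
  assumes "is_ef q"
  shows "ram (trunc k q) dvd ram q"
  unfolding ram_dvd_iff [OF is_ef_trunc [OF assms]]
  using denom_dvd_ram [OF assms] by (simp add: trunc_apply)

lemma ram_strict_trunc_dvd:
  assumes "is_ef q"
  shows "ram (strict_trunc k q) dvd ram (trunc k q)"
  unfolding ram_dvd_iff [OF is_ef_strict_trunc [OF assms]]
proof (intro allI impI)
  fix x assume "strict_trunc k q x \<noteq> 0"
  then have "trunc k q x \<noteq> 0"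
    by (auto simp: trunc_apply strict_trunc_apply split: if_splits)
  then show "denom x dvd ram (trunc k q)"
    by (rule denom_dvd_ram [OF is_ef_trunc [OF assms]])
qed

lemma denom_dvd_ram_trunc: "is_ef q \<Longrightarrow> q k \<noteq> 0 \<Longrightarrow> denom k dvd ram (trunc k q)"
  by (rule denom_dvd_ram [OF is_ef_trunc]) (simp_all add: trunc_apply)

lemma trunc_eq_iff:
  "trunc k p = trunc k q \<longleftrightarrow> strict_trunc k p = strict_trunc k q \<and> p k = q k"
proof -
  have "trunc k p x = trunc k q x \<longleftrightarrow>
      strict_trunc k p x = strict_trunc k q x \<and> (x = k \<longrightarrow> p k = q k)" for x
    by (cases x k rule: linorder_cases) (simp_all add: trunc_apply strict_trunc_apply)
  then show ?thesis
    by (auto simp: fun_eq_iff)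
qed

lemma gal_funpow_eq_iff_trunc:
  "(\<forall>x\<ge>k. (gal ^^ i) p x = (gal ^^ j) q x) \<longleftrightarrow> (gal ^^ i) (trunc k p) = (gal ^^ j) (trunc k q)"
  unfolding fun_eq_iff by (intro all_cong1) (simp add: gal_funpow trunc_apply)

lemma gal_funpow_eq_iff_strict_trunc:
  "(\<forall>x>k. (gal ^^ i) p x = (gal ^^ j) q x) \<longleftrightarrow>
   (gal ^^ i) (strict_trunc k p) = (gal ^^ j) (strict_trunc k q)"
  unfolding fun_eq_iff by (intro all_cong1) (simp add: gal_funpow strict_trunc_apply)

lemma gal_funpow_same_iff:
  assumes "is_ef q"
  shows "(gal ^^ i) q = (gal ^^ j) q \<longleftrightarrow> int (ram q) dvd int i - int j"
  unfolding fun_eq_iff ram_dvd_int_iff [OF assms]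
  by (intro all_cong1) (auto simp: gal_funpow zeta_power_eq_iff)

lemma gal_funpow_ram: "is_ef q \<Longrightarrow> (gal ^^ (ram q * i)) q = q"
  using gal_funpow_same_iff [of q "ram q * i" 0] by (simp only: funpow_0) simp

lemma self_in_circ: "q \<in> circ q"
  unfolding circ_def by (rule range_eqI [of _ _ 0]) simp

lemma circ_eqI:
  assumes "is_ef p" "is_ef q" "(gal ^^ i) p = (gal ^^ j) q"
  shows "circ p = circ q"
proof -
  have sub: "circ q \<subseteq> circ p" if "is_ef q" "(gal ^^ i) p = (gal ^^ j) q" for p q i j
  proof -
    have "j \<le> ram q * j"
      using ram_pos [OF that(1)] by simp
    \<comment> \<open>A natural iterate undoes the shift by \<open>j\<close>: together they make the
      multiple \<open>ram q * j\<close>, which acts trivially on \<open>q\<close>.\<close>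
    have "q = (gal ^^ (ram q * j - j)) ((gal ^^ j) q)"
      using gal_funpow_ram [OF that(1), of j] \<open>j \<le> ram q * j\<close>
      by (simp flip: funpow_add comp_apply [of "gal ^^ _" "gal ^^ _"])
    then have "q = (gal ^^ (ram q * j - j + i)) p"
      by (simp add: funpow_add that(2))
    then have "(gal ^^ n) q = (gal ^^ (n + (ram q * j - j + i))) p" for n
      by (metis comp_apply funpow_add)
    then show ?thesis
      by (auto simp: circ_def)
  qed
  show ?thesis
    using sub [OF assms(2,3)] sub [OF assms(1) assms(3) [symmetric]] by blast
qed

lemma ram_SOME_circ:
  assumes "is_ef q"
  shows "ram (SOME p. p \<in> circ q) = ram q"
proof -
  have "(SOME p. p \<in> circ q) \<in> circ q"
    using self_in_circ by (auto simp: some_in_eq)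
  then obtain i where "(SOME p. p \<in> circ q) = (gal ^^ i) q"
    by (auto simp: circ_def)
  moreover have "ram ((gal ^^ i) q) = ram q"
    by (simp add: ram_def gal_funpow)
  ultimately show ?thesis
    by simp
qed

section \<open>Slopes, levels and admissible heights\<close>

text \<open>Slope 0 is the default for the zero factor, while a leading exponent is always positive;
  hence the extra conjunct \<open>e \<noteq> 0\<close>.\<close>

lemma slope_eq_nonzero_iff:
  assumes "is_ef h"
  shows "slope h = e \<and> e \<noteq> 0 \<longleftrightarrow> h e \<noteq> 0 \<and> (\<forall>k>e. h k = 0)"
proof (cases "{k. h k \<noteq> 0} = {}")
  case False
  have fin: "finite {k. h k \<noteq> 0}" and pos: "\<And>k. h k \<noteq> 0 \<Longrightarrow> 0 < k"
    using assms by (auto simp: is_ef_def)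
  have "slope h = e \<longleftrightarrow> h e \<noteq> 0 \<and> (\<forall>k>e. h k = 0)"
    using False fin by (auto simp: slope_def Max_eq_iff) (metis not_le)
  then show ?thesis
    using pos by fastforce
qed (auto simp: slope_def)

lemma slope_ge:
  assumes "is_ef h" "h k \<noteq> 0"
  shows "k \<le> slope h"
proof -
  have "finite {k. h k \<noteq> 0}" "k \<in> {k. h k \<noteq> 0}"
    using assms by (auto simp: is_ef_def)
  then show ?thesis
    unfolding slope_def using Max_ge by auto
qed

lemma slope_eq_0_iff:
  assumes "is_ef h"
  shows "slope h = 0 \<longleftrightarrow> (\<forall>k. h k = 0)"
proof
  assume "slope h = 0"
  then show "\<forall>k. h k = 0"
    using slope_ge [OF assms] assms by (force simp: is_ef_def)
qed (auto simp: slope_def)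

text \<open>Prescribing a slope imposes one condition at each exponent separately; this is why
  \<open>BQ\<close> splits as a product over the heights.\<close>

lemma slope_eq_slope_iff:
  assumes "is_ef h" "is_ef g"
  shows "slope h = slope g \<longleftrightarrow>
    (\<forall>e>0. ((\<forall>k\<ge>e. g k = 0) \<longrightarrow> h e = 0) \<and> (g e \<noteq> 0 \<and> (\<forall>k>e. g k = 0) \<longrightarrow> h e \<noteq> 0))"
    (is "_ \<longleftrightarrow> ?R")
proof
  assume eq: "slope h = slope g"
  show ?R
  proof (intro allI impI conjI)
    fix e :: rat assume e: "0 < e" and g: "\<forall>k\<ge>e. g k = 0"
    show "h e = 0"
    proof (rule ccontr)
      assume "h e \<noteq> 0"
      then have "e \<le> slope g"
        using slope_ge [OF assms(1)] eq by simp
      then have "g (slope g) \<noteq> 0"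
        using slope_eq_nonzero_iff [OF assms(2), of "slope g"] e by simp
      with g \<open>e \<le> slope g\<close> show False
        by simp
    qed
  next
    fix e :: rat assume "g e \<noteq> 0 \<and> (\<forall>k>e. g k = 0)"
    then have "slope h = e \<and> e \<noteq> 0"
      using slope_eq_nonzero_iff [OF assms(2)] eq by simp
    then show "h e \<noteq> 0"
      using slope_eq_nonzero_iff [OF assms(1)] by simp
  qed
next
  assume R: ?R
  have pos: "\<And>k. h k \<noteq> 0 \<Longrightarrow> 0 < k" "\<And>k. g k \<noteq> 0 \<Longrightarrow> 0 < k"
    using assms by (auto simp: is_ef_def)
  show "slope h = slope g"
  proof (cases "slope g = 0")
    case True
    then have "\<forall>k. h k = 0"
      using R pos(1) slope_eq_0_iff [OF assms(2)] by blast
    with True show ?thesis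
      using slope_eq_0_iff [OF assms(1)] by simp
  next
    case False
    define e where "e = slope g"
    have g: "g e \<noteq> 0" "\<forall>k>e. g k = 0"
      using slope_eq_nonzero_iff [OF assms(2), of e] False e_def by auto
    then have "h e \<noteq> 0"
      using R pos(2) by blast
    moreover have "\<forall>k>e. h k = 0"
    proof (intro allI impI)
      fix k assume "e < k"
      then have "0 < k" "\<forall>k'\<ge>k. g k' = 0"
        using g pos(2) [of e] by auto
      then show "h k = 0"
        using R by blast
    qed
    ultimately show ?thesis
      using slope_eq_nonzero_iff [OF assms(1), of e] e_def by auto
  qed
qed

text \<open>Where \<open>q k\<close> is nonzero, the shift by \<open>i\<close> fixes that
  coefficient iff \<open>denom k\<close> divides \<open>i\<close>. The shifts fixing everything
  above \<open>e\<close> are thus the multiples of \<open>ram (strict_trunc e q)\<close>, and if any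
  of them moves the coefficient at \<open>e\<close>, then this ramification itself does.\<close>

lemma mem_levels_iff:
  assumes "is_ef q"
  shows "e \<in> levels q \<longleftrightarrow> q e \<noteq> 0 \<and> \<not> denom e dvd ram (strict_trunc e q)"
proof -
  have "e \<in> levels q \<longleftrightarrow> (\<exists>i. slope (\<lambda>x. (gal ^^ 0) q x - (gal ^^ i) q x) = e \<and> e \<noteq> 0)"
    by (auto simp: levels_def)
  also have "\<dots> \<longleftrightarrow> (\<exists>i. q e \<noteq> q e * zeta e ^ i \<and> (\<forall>k>e. q k = q k * zeta k ^ i))"
    unfolding slope_eq_nonzero_iff [OF is_ef_diff_gal [OF assms assms]] by (simp add: gal_funpow)
  also have "\<dots> \<longleftrightarrow> (\<exists>i. q e \<noteq> 0 \<and> \<not> denom e dvd i \<and> (\<forall>k>e. q k \<noteq> 0 \<longrightarrow> denom k dvd i))"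
    by (auto simp flip: zeta_power_eq_1_iff)
  also have "\<dots> \<longleftrightarrow> (\<exists>i. q e \<noteq> 0 \<and> \<not> denom e dvd i \<and> ram (strict_trunc e q) dvd i)"
    using assms by (auto simp: ram_dvd_iff is_ef_strict_trunc strict_trunc_apply)
  also have "\<dots> \<longleftrightarrow> q e \<noteq> 0 \<and> \<not> denom e dvd ram (strict_trunc e q)"
    by (auto intro: dvd_trans)
  finally show ?thesis .
qed

lemma finite_levels:
  assumes "is_ef q"
  shows "finite (levels q)"
proof (rule finite_subset)
  show "levels q \<subseteq> {k. q k \<noteq> 0}"
    using mem_levels_iff [OF assms] by blast
  show "finite {k. q k \<noteq> 0}"
    using assms by (simp add: is_ef_def)
qed

text \<open>Levels are the places where the lcm of the denominators, accumulated from the largest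
  exponent downwards, grows; the remaining denominators contribute nothing.\<close>

lemma ram_trunc_eq_Lcm_levels:
  assumes "is_ef q"
  shows "ram (trunc e q) = Lcm (denom ` {k \<in> levels q. e \<le> k})" (is "_ = ?M")
proof (rule dvd_antisym)
  have "denom k dvd ?M" if "q k \<noteq> 0" "e \<le> k" for k
  proof (rule ccontr)
    assume "\<not> denom k dvd ?M"
    define B where "B = {k. q k \<noteq> 0 \<and> e \<le> k \<and> \<not> denom k dvd ?M}"
    have fin: "finite B" and ne: "B \<noteq> {}"
      using assms that \<open>\<not> denom k dvd ?M\<close> by (auto simp: B_def is_ef_def)
    \<comment> \<open>Beyond the largest exponent with a missing denominator all denominators divide
      \<open>?M\<close>, so this exponent is a level and its denominator is present after
      all.\<close>
    define k' where "k' = Max B"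
    have k': "k' \<in> B" "\<And>x. x \<in> B \<Longrightarrow> x \<le> k'"
      using fin ne by (auto simp: k'_def)
    have "ram (strict_trunc k' q) dvd ?M"
      unfolding ram_dvd_iff [OF is_ef_strict_trunc [OF assms]]
    proof (intro allI impI)
      fix x assume "strict_trunc k' q x \<noteq> 0"
      then have "k' < x" "q x \<noteq> 0"
        by (auto simp: strict_trunc_def split: if_splits)
      with k' show "denom x dvd ?M"
        unfolding B_def by force
    qed
    then have "k' \<in> levels q"
      using k'(1) by (auto simp: mem_levels_iff [OF assms] B_def dest: dvd_trans)
    then have "denom k' dvd ?M"
      using k'(1) by (intro dvd_Lcm) (auto simp: B_def)
    then show False
      using k'(1) by (simp add: B_def)
  qed
  then show "ram (trunc e q) dvd ?M"
    by (auto simp: ram_dvd_iff assms is_ef_trunc trunc_apply)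
  show "?M dvd ram (trunc e q)"
    using assms by (auto intro!: Lcm_least denom_dvd_ram simp: is_ef_trunc mem_levels_iff trunc_apply)
qed

lemma denom_eq_1_iff: "denom x = 1 \<longleftrightarrow> x \<in> \<int>"
  using mult_in_Ints_iff_denom_dvd [of 1 x] by (simp only: of_nat_1 mult_1 nat_dvd_1_iff_1)

text \<open>\<open>rlev\<close> at a level \<open>k\<close> is the ramification of
  \<open>trunc k q\<close>, and this ramification does not change between consecutive levels. The
  positive integers are the heights of denominator 1.\<close>

lemma mem_Aset_levels_iff:
  assumes "is_ef q"
  shows "e \<in> Aset (levels q) \<longleftrightarrow> 0 < e \<and> denom e dvd ram (trunc e q)"
proof -
  let ?L = "\<lambda>e. {k \<in> levels q. e \<le> k}"
  have fin: "finite (?L e)" for e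
    using finite_levels [OF assms] by simp
  have rlev: "rlev (levels q) k = ram (trunc k q)" for k
    by (simp add: rlev_def ram_trunc_eq_Lcm_levels [OF assms])
  have nat: "(\<exists>n::nat. 0 < n \<and> e = of_nat n) \<longleftrightarrow> 0 < e \<and> denom e = 1"
  proof
    assume "0 < e \<and> denom e = 1"
    then have "\<exists>j::nat. e = of_nat j / of_nat 1"
      by (subst eq_divide_of_nat_iff_denom_dvd) auto
    with \<open>0 < e \<and> denom e = 1\<close> show "\<exists>n::nat. 0 < n \<and> e = of_nat n"
      by auto
  next
    assume "\<exists>n::nat. 0 < n \<and> e = of_nat n"
    then show "0 < e \<and> denom e = 1"
      unfolding denom_eq_1_iff by auto
  qed
  have "e \<in> Aset (levels q) \<longleftrightarrow>
      0 < e \<and> (denom e = 1 \<or> (\<exists>k\<in>?L e. \<exists>n::nat. e = of_nat n / of_nat (ram (trunc k q))))"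
    unfolding Aset_def rlev Un_iff UN_iff mem_Collect_eq nat by blast
  also have "\<dots> \<longleftrightarrow> 0 < e \<and> (denom e = 1 \<or> (\<exists>k\<in>?L e. denom e dvd ram (trunc k q)))"
    using eq_divide_of_nat_iff_denom_dvd [OF _ ram_pos [OF is_ef_trunc [OF assms]]] by blast
  also have "\<dots> \<longleftrightarrow> 0 < e \<and> denom e dvd ram (trunc e q)"
  proof (intro conj_cong refl iffI)
    assume "denom e = 1 \<or> (\<exists>k\<in>?L e. denom e dvd ram (trunc k q))"
    then show "denom e dvd ram (trunc e q)"
    proof
      assume "\<exists>k\<in>?L e. denom e dvd ram (trunc k q)"
      then obtain k where "e \<le> k" "denom e dvd ram (trunc k q)"
        by blast
      moreover have "ram (trunc k q) dvd ram (trunc e q)"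
        using \<open>e \<le> k\<close> unfolding ram_trunc_eq_Lcm_levels [OF assms]
        by (intro Lcm_subset) auto
      ultimately show ?thesis
        using dvd_trans by blast
    qed simp
  next
    assume d: "denom e dvd ram (trunc e q)"
    show "denom e = 1 \<or> (\<exists>k\<in>?L e. denom e dvd ram (trunc k q))"
    proof (cases "?L e = {}")
      case True
      then have "ram (trunc e q) = 1"
        unfolding ram_trunc_eq_Lcm_levels [OF assms] True by simp
      with d show ?thesis
        by simp
    next
      case False
      \<comment> \<open>The smallest level not below \<open>e\<close>. No level lies between, so
        truncating at \<open>k\<close> or at \<open>e\<close> gives the same ramification.\<close>
      define k where "k = Min (?L e)"
      have "k \<in> ?L e" "?L k = ?L e"
        unfolding k_def using Min_in [OF fin False] Min_le [OF fin, of _ e] by (auto intro: order_trans)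
      with d show ?thesis
        unfolding ram_trunc_eq_Lcm_levels [OF assms] by auto
    qed
  qed
  finally show ?thesis .
qed

text \<open>A count: the powers with exponent below \<open>N\<close> are \<open>N\<close> distinct
  roots, and there are exactly \<open>N\<close> roots.\<close>

lemma roots_of_unity_eq_powers:
  fixes w :: complex
  assumes "0 < N" and w: "\<And>t. w ^ t = 1 \<longleftrightarrow> N dvd t"
  shows "{z. z ^ N = 1} = (\<lambda>t. w ^ t) ` {..<N}"
proof (rule card_subset_eq [symmetric])
  show "finite {z::complex. z ^ N = 1}"
    using assms by (intro finite_nth_roots) auto
  show "(\<lambda>t. w ^ t) ` {..<N} \<subseteq> {z. z ^ N = 1}"
    by (auto simp: w simp flip: power_mult)
  have w0: "w \<noteq> 0"
    using w [of N] assms(1) by (auto simp: power_0_left)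
  have "s = t" if "s \<le> t" "t < N" "w ^ s = w ^ t" for s t
  proof -
    have "w ^ t = w ^ s * w ^ (t - s)"
      using that(1) by (simp flip: power_add)
    then have "w ^ (t - s) = 1"
      using that w0 by simp
    then show ?thesis
      using that w by (meson dvd_imp_le leD le_less_trans diff_le_self zero_less_diff le_neq_implies_less)
  qed
  then have "inj_on (\<lambda>t. w ^ t) {..<N}"
    by (intro inj_onI) (metis lessThan_iff linear)
  then show "card ((\<lambda>t. w ^ t) ` {..<N}) = card {z::complex. z ^ N = 1}"
    using assms by (simp add: card_image card_roots_unity_eq)
qed

section \<open>Complements of root-of-unity arrangements\<close>

text \<open>The common form of \<open>Bv\<close>, \<open>Xconf\<close> and \<open>Xstar\<close>:
  \<open>W\<close> indexes the coordinates, those in \<open>M\<close> must be nonzero, and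
  \<open>N\<close> is the order of the roots of unity up to which coordinates are separated.\<close>

definition avoid_space :: "'w set \<Rightarrow> 'w set \<Rightarrow> nat \<Rightarrow> ('w \<Rightarrow> complex) set" where
  "avoid_space W M N = {c. (\<forall>w. w \<notin> W \<longrightarrow> c w = 0) \<and> (\<forall>w\<in>W. w \<in> M \<longrightarrow> c w \<noteq> 0) \<and>
     (\<forall>u\<in>W. \<forall>w\<in>W. u \<noteq> w \<longrightarrow> c u ^ N \<noteq> c w ^ N)}"

text \<open>Two points are joined inside the complex line through them: the conditions fail at only
  finitely many parameters, and the plane minus a finite set is path-connected.\<close>

lemma path_connected_avoid_space:
  assumes "finite W"
  shows "path_connected (avoid_space W M N)"
  unfolding path_connected_def
proof (intro ballI)
  fix x y assume x: "x \<in> avoid_space W M N" and y: "y \<in> avoid_space W M N"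
  define l where "l w = [:x w, y w - x w:]" for w
  define p where "p u w = l u ^ N - l w ^ N" for u w
  have l01: "poly (l w) 0 = x w" "poly (l w) 1 = y w" for w
    by (simp_all add: l_def)
  \<comment> \<open>The bad parameters, as roots of polynomials. None of these polynomials is zero,
    because \<open>x\<close>, the point at parameter 0, satisfies every condition.\<close>
  define Z where "Z = (\<Union>w\<in>W \<inter> M. {z. poly (l w) z = 0}) \<union>
      (\<Union>u\<in>W. \<Union>w\<in>W - {u}. {z. poly (p u w) z = 0})"
  have "l w \<noteq> 0" if "w \<in> W \<inter> M" for w
    using that x l01(1) [of w] by (auto simp: avoid_space_def)
  moreover have "p u w \<noteq> 0" if "u \<in> W" "w \<in> W - {u}" for u w
  proof -
    have "poly (p u w) 0 \<noteq> 0"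
      using that x by (auto simp: avoid_space_def p_def l01)
    then show ?thesis
      by auto
  qed
  ultimately have "finite Z"
    unfolding Z_def using assms by (intro finite_UnI finite_UN_I poly_roots_finite) auto
  then have "path_connected (- Z)"
    by (intro path_connected_complement_countable countable_finite) simp_all
  moreover have "0 \<notin> Z" "1 \<notin> Z"
    using x y unfolding Z_def avoid_space_def p_def by (auto simp: l01)
  ultimately obtain g where g: "path g" "path_image g \<subseteq> - Z" "pathstart g = 0" "pathfinish g = 1"
    unfolding path_connected_def by (metis ComplI)
  define h where "h t = (\<lambda>w. x w + g t * (y w - x w))" for t
  have h: "h t w = poly (l w) (g t)" for t w
    by (simp add: h_def l_def)
  show "\<exists>h. path h \<and> path_image h \<subseteq> avoid_space W M N \<and> pathstart h = x \<and> pathfinish h = y"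
  proof (intro exI conjI)
    show "path h"
      using g(1) unfolding path_def h_def
      by (intro continuous_on_coordinatewise_then_product continuous_intros)
    show "path_image h \<subseteq> avoid_space W M N"
    proof
      fix c assume "c \<in> path_image h"
      then obtain t where t: "t \<in> {0..1}" "c = h t"
        by (auto simp: path_image_def)
      then have "g t \<notin> Z"
        using g(2) unfolding path_image_def by blast
      then have "poly (l w) (g t) \<noteq> 0" if "w \<in> W" "w \<in> M" for w
        using that unfolding Z_def by blast
      moreover have "poly (l u) (g t) ^ N \<noteq> poly (l w) (g t) ^ N" if "u \<in> W" "w \<in> W" "u \<noteq> w" for u w
      proof -
        have "poly (p u w) (g t) \<noteq> 0"
          using that \<open>g t \<notin> Z\<close> unfolding Z_def by blast
        then show ?thesis
          by (simp add: p_def)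
      qed
      moreover have "h t w = 0" if "w \<notin> W" for w
        using that x y by (simp add: h_def avoid_space_def)
      ultimately show "c \<in> avoid_space W M N"
        unfolding avoid_space_def t(2) by (simp add: h)
    qed
    show "pathstart h = x" "pathfinish h = y"
      using g(3,4) by (auto simp: h_def pathstart_def pathfinish_def)
  qed
qed

lemma homeomorphism_avoid_space:
  assumes f: "bij_betw f W V"
  shows "homeomorphism (avoid_space W M N) (avoid_space V (f ` (M \<inter> W)) N)
    (\<lambda>c v. if v \<in> V then c (inv_into W f v) else 0) (\<lambda>c w. if w \<in> W then c (f w) else 0)"
    (is "homeomorphism ?S ?T ?F ?G")
proof -
  let ?g = "inv_into W f"
  have g: "?g v \<in> W" "f (?g v) = v" if "v \<in> V" for v
    using that f by (auto simp: bij_betw_def inv_into_into f_inv_into_f)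
  have f': "f w \<in> V" "?g (f w) = w" if "w \<in> W" for w
    using that f by (auto simp: bij_betw_def)
  have GF: "?G (?F c) = c" if "c \<in> ?S" for c
    using that f' by (auto simp: avoid_space_def fun_eq_iff)
  have FG: "?F (?G c) = c" if "c \<in> ?T" for c
    using that g by (auto simp: avoid_space_def fun_eq_iff)
  have F: "?F c \<in> ?T" if c: "c \<in> ?S" for c
    unfolding avoid_space_def
  proof (intro CollectI conjI ballI allI impI)
    show "?F c v \<noteq> 0" if "v \<in> V" "v \<in> f ` (M \<inter> W)" for v
      using that c f' by (auto simp: avoid_space_def)
    show "?F c u ^ N \<noteq> ?F c v ^ N" if "u \<in> V" "v \<in> V" "u \<noteq> v" for u v
    proof -
      have "?g u \<noteq> ?g v"
        using that g(2) by metis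
      then show ?thesis
        using that c g(1) by (simp add: avoid_space_def)
    qed
  qed auto
  have G: "?G c \<in> ?S" if c: "c \<in> ?T" for c
    unfolding avoid_space_def
  proof (intro CollectI conjI ballI allI impI)
    show "?G c w \<noteq> 0" if "w \<in> W" "w \<in> M" for w
      using that c f' by (auto simp: avoid_space_def)
    show "?G c u ^ N \<noteq> ?G c v ^ N" if "u \<in> W" "v \<in> W" "u \<noteq> v" for u v
    proof -
      have "f u \<noteq> f v"
        using that f'(2) by metis
      then show ?thesis
        using that c f'(1) by (simp add: avoid_space_def)
    qed
  qed auto
  have "continuous_on ?S ?F"
  proof (rule continuous_on_coordinatewise_then_product)
    show "continuous_on ?S (\<lambda>c. if v \<in> V then c (?g v) else 0)" for v
      by (cases "v \<in> V") (auto intro: continuous_on_product_then_coordinatewise continuous_on_id)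
  qed
  moreover have "continuous_on ?T ?G"
  proof (rule continuous_on_coordinatewise_then_product)
    show "continuous_on ?T (\<lambda>c. if w \<in> W then c (f w) else 0)" for w
      by (cases "w \<in> W") (auto intro: continuous_on_product_then_coordinatewise continuous_on_id)
  qed
  ultimately show ?thesis
    using F G GF FG by (intro homeomorphismI) (auto simp: image_subset_iff)
qed

lemma Xconf_eq_avoid_space: "Xconf n = avoid_space {..<n} {} 1"
  by (auto simp: Xconf_def avoid_space_def)

lemma power_eq_iff_root_of_unity:
  fixes a b :: complex
  assumes "b \<noteq> 0"
  shows "a ^ N = b ^ N \<longleftrightarrow> (\<exists>z. z ^ N = 1 \<and> a = z * b)"
proof
  assume "a ^ N = b ^ N"
  then have "(a / b) ^ N = 1 \<and> a = a / b * b"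
    using assms by (simp add: power_divide)
  then show "\<exists>z. z ^ N = 1 \<and> a = z * b" ..
qed (auto simp: power_mult_distrib)

text \<open>For nonzero coordinates, equal \<open>N\<close>-th powers mean that the quotient is an
  \<open>N\<close>-th root of unity; a point with a vanishing coordinate lies on neither
  side.\<close>

lemma Xstar_eq_avoid_space: "Xstar n N = avoid_space {..<n} {..<n} N"
proof (rule Set.set_eqI)
  fix a :: "nat \<Rightarrow> complex"
  show "a \<in> Xstar n N \<longleftrightarrow> a \<in> avoid_space {..<n} {..<n} N"
  proof (cases "\<forall>i<n. a i \<noteq> 0")
    case True
    then show ?thesis
      by (simp add: Xstar_def avoid_space_def power_eq_iff_root_of_unity not_less Ball_def)
  qed (auto simp: Xstar_def avoid_space_def)
qed

text \<open>After relabelling \<open>W\<close> by an initial segment only the marked set and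
  \<open>N\<close> matter. The last hypothesis excludes mixed arrangements: either there are plain
  diagonals and no coordinate hyperplanes, or all coordinate hyperplanes are present.\<close>

lemma fundamental_group_avoid_space_iso:
  assumes "finite W" "x \<in> avoid_space W M N" "0 < N"
    and "W \<inter> M = {} \<and> N = 1 \<or> W \<subseteq> M"
  shows "(\<exists>n. \<exists>y\<in>Xconf n. fundamental_group (avoid_space W M N) x \<cong> fundamental_group (Xconf n) y) \<or>
     (\<exists>n N'. 0 < N' \<and> (\<exists>y\<in>Xstar n N'.
        fundamental_group (avoid_space W M N) x \<cong> fundamental_group (Xstar n N') y))"
proof -
  obtain f and n :: nat where f: "bij_betw f W {..<n}"
    using ex_bij_betw_finite_nat [OF assms(1)] by (auto simp: atLeast0LessThan)
  have "\<exists>y\<in>avoid_space {..<n} (f ` (M \<inter> W)) N. fundamental_group (avoid_space W M N) x \<cong>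
      fundamental_group (avoid_space {..<n} (f ` (M \<inter> W)) N) y"
    using fundamental_group_iso_homeomorphism [OF homeomorphism_avoid_space [OF f, of M N] assms(2)]
      homeomorphism_image1 [OF homeomorphism_avoid_space [OF f, of M N]] assms(2) by blast
  then show ?thesis
    using assms(4)
  proof (elim disjE conjE)
    assume "W \<inter> M = {}" "N = 1"
    then have "avoid_space {..<n} (f ` (M \<inter> W)) N = Xconf n"
      by (simp add: Xconf_eq_avoid_space Int_commute)
    with \<open>\<exists>y\<in>_. _\<close> show ?thesis
      by auto
  next
    assume "W \<subseteq> M"
    then have "avoid_space {..<n} (f ` (M \<inter> W)) N = Xstar n N"
      using f by (simp add: Xstar_eq_avoid_space bij_betw_def Int_absorb1)
    with \<open>\<exists>y\<in>_. _\<close> assms(3) show ?thesis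
      by (intro disjI2 exI [of _ n] exI [of _ N]) simp
  qed
qed

section \<open>Slope conditions at one exponent\<close>

lemma gal_funpow_trunc_eq_iff:
  "(gal ^^ k) (trunc e p) = (gal ^^ l) (trunc e q) \<longleftrightarrow>
   (gal ^^ k) (strict_trunc e p) = (gal ^^ l) (strict_trunc e q) \<and> p e * zeta e ^ k = q e * zeta e ^ l"
proof -
  have "(gal ^^ k) (trunc e p) x = (gal ^^ l) (trunc e q) x \<longleftrightarrow>
      (gal ^^ k) (strict_trunc e p) x = (gal ^^ l) (strict_trunc e q) x \<and>
      (x = e \<longrightarrow> p e * zeta e ^ k = q e * zeta e ^ l)" for x
    by (cases x e rule: linorder_cases) (simp_all add: gal_funpow trunc_apply strict_trunc_apply)
  then show ?thesis
    by (auto simp: fun_eq_iff)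
qed

section \<open>Consequences of compatibility\<close>

locale compatible_pit =
  fixes Q :: pit
  assumes is_pit: "is_pit Q" and compatible: "compatible Q"
begin

abbreviation q :: "nat \<Rightarrow> ef" where
  "q i \<equiv> snd (Q ! i)"

abbreviation m :: nat where
  "m \<equiv> length Q"

text \<open>For positive \<open>e\<close> this is membership of \<open>e\<close> in
  \<open>Aset (levels (q i))\<close>, by \<open>mem_Aset_levels_iff\<close>.\<close>

definition adm :: "nat \<Rightarrow> rat \<Rightarrow> bool" where
  "adm i e \<longleftrightarrow> denom e dvd ram (trunc e (q i))"

definition parent_ram :: "nat \<Rightarrow> rat \<Rightarrow> nat" where
  "parent_ram i e = ram (strict_trunc e (q i))"

text \<open>This is \<open>Nv\<close> of the parent seen from the child at height \<open>e\<close>,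
  so that conditions at one exponent can be stated without the tree.\<close>

definition branching :: "nat \<Rightarrow> rat \<Rightarrow> nat" where
  "branching i e = lcm (parent_ram i e) (denom e) div parent_ram i e"

definition node :: "nat \<Rightarrow> rat \<Rightarrow> node" where
  "node i e = (e, circ (trunc e (q i)))"

lemma is_ef: "i < m \<Longrightarrow> is_ef (q i)"
  using is_pit by (simp add: is_pit_def)

lemma trunc_eqI:
  assumes "i < m" "j < m" "(gal ^^ k) (trunc e (q i)) = (gal ^^ l) (trunc e (q j))"
  shows "trunc e (q i) = trunc e (q j)"
proof -
  have "circ (trunc e (q i)) = circ (trunc e (q j))"
    using assms by (intro circ_eqI [OF _ _ assms(3)] is_ef_trunc is_ef)
  then show ?thesis
    using compatible assms(1,2) by (simp add: compatible_def)
qed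

text \<open>Compatibility speaks of \<open>trunc\<close> only. As supports are finite, a cut
  \<open>d\<close> slightly above \<open>e\<close> turns both strict truncations into ordinary
  ones.\<close>

lemma strict_trunc_eqI:
  assumes ij: "i < m" "j < m" and eq: "(gal ^^ k) (strict_trunc e (q i)) = (gal ^^ l) (strict_trunc e (q j))"
  shows "strict_trunc e (q i) = strict_trunc e (q j)"
proof -
  define B where "B = {x. e < x \<and> (q i x \<noteq> 0 \<or> q j x \<noteq> 0)}"
  have "finite ({x. q i x \<noteq> 0} \<union> {x. q j x \<noteq> 0})"
    using is_ef ij by (auto simp: is_ef_def)
  then have fin: "finite B"
    by (rule rev_finite_subset) (auto simp: B_def)
  obtain d where d: "e < d" "\<And>x. x \<in> B \<Longrightarrow> d \<le> x"
  proof (cases "B = {}")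
    case True
    then show ?thesis
      using that [of "e + 1"] by simp
  next
    case False
    then have "e < Min B"
      using fin by (simp add: B_def)
    then show ?thesis
      using that [of "Min B"] fin by simp
  qed
  have "strict_trunc e p = trunc d p" if "\<And>x. e < x \<Longrightarrow> p x \<noteq> 0 \<Longrightarrow> x \<in> B" for p
    using that d by (fastforce simp: strict_trunc_apply trunc_apply fun_eq_iff)
  then have "strict_trunc e (q i) = trunc d (q i)" "strict_trunc e (q j) = trunc d (q j)"
    by (auto simp: B_def)
  with eq show ?thesis
    using trunc_eqI [OF ij] by metis
qed

lemma parent_ram_pos: "i < m \<Longrightarrow> 0 < parent_ram i e"
  by (simp add: parent_ram_def ram_pos is_ef_strict_trunc is_ef)

lemma parent_ram_mult_branching: "i < m \<Longrightarrow> parent_ram i e * branching i e = lcm (parent_ram i e) (denom e)"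
  by (simp add: branching_def)

lemma branching_pos: "i < m \<Longrightarrow> 0 < branching i e"
  using parent_ram_mult_branching [of i e] parent_ram_pos [of i e] denom_pos [of e]
  by (metis lcm_pos_nat nat_0_less_mult_iff)

lemma branching_eq_1_iff:
  assumes "i < m"
  shows "branching i e = 1 \<longleftrightarrow> denom e dvd parent_ram i e"
proof
  assume "branching i e = 1"
  then show "denom e dvd parent_ram i e"
    using parent_ram_mult_branching [OF assms, of e] by (metis dvd_lcm2 mult.right_neutral)
next
  assume "denom e dvd parent_ram i e"
  then show "branching i e = 1"
    using parent_ram_pos [OF assms] by (simp add: branching_def lcm_proj1_if_dvd_nat)
qed

lemma admI: "i < m \<Longrightarrow> q i e \<noteq> 0 \<Longrightarrow> adm i e"
  unfolding adm_def by (rule denom_dvd_ram_trunc [OF is_ef])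

lemma adm_if_dvd_parent_ram: "i < m \<Longrightarrow> denom e dvd parent_ram i e \<Longrightarrow> adm i e"
  unfolding adm_def parent_ram_def by (rule dvd_trans [OF _ ram_strict_trunc_dvd [OF is_ef]])

lemma coeff_nonzero_if_adm:
  assumes "i < m" "adm i e" "\<not> denom e dvd parent_ram i e"
  shows "q i e \<noteq> 0"
proof
  assume "q i e = 0"
  then have "trunc e (q i) = strict_trunc e (q i)"
    by (auto simp: trunc_apply strict_trunc_apply fun_eq_iff)
  with assms show False
    by (simp add: adm_def parent_ram_def)
qed

text \<open>What \<open>pit_equiv\<close> requires at the exponent \<open>e\<close>, where \<open>x i\<close> is the coefficient of the \<open>i\<close>-th
  exponential factor at \<open>e\<close>: coefficients depend only on the node, vanish at non-admissible nodes,
  do not vanish at mandatory ones, and siblings are separated up to \<open>branching\<close>-th roots of unity.\<close>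

definition height_cond :: "rat \<Rightarrow> (nat \<Rightarrow> complex) \<Rightarrow> bool" where
  "height_cond e x \<longleftrightarrow>
    (\<forall>i<m. \<forall>j<m. trunc e (q i) = trunc e (q j) \<longrightarrow> x i = x j) \<and>
    (\<forall>i<m. \<not> adm i e \<longrightarrow> x i = 0) \<and>
    (\<forall>i<m. adm i e \<and> \<not> denom e dvd parent_ram i e \<longrightarrow> x i \<noteq> 0) \<and>
    (\<forall>i<m. \<forall>j<m. strict_trunc e (q i) = strict_trunc e (q j) \<and> trunc e (q i) \<noteq> trunc e (q j)
       \<longrightarrow> x i ^ branching i e \<noteq> x j ^ branching i e)"

lemma height_cond_eq:
  "height_cond e x \<Longrightarrow> i < m \<Longrightarrow> j < m \<Longrightarrow> trunc e (q i) = trunc e (q j) \<Longrightarrow> x i = x j"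
  unfolding height_cond_def by blast

lemma height_cond_zero: "height_cond e x \<Longrightarrow> i < m \<Longrightarrow> \<not> adm i e \<Longrightarrow> x i = 0"
  unfolding height_cond_def by blast

lemma height_cond_nonzero:
  "height_cond e x \<Longrightarrow> i < m \<Longrightarrow> adm i e \<Longrightarrow> \<not> denom e dvd parent_ram i e \<Longrightarrow> x i \<noteq> 0"
  unfolding height_cond_def by blast

lemma height_cond_power:
  "height_cond e x \<Longrightarrow> i < m \<Longrightarrow> j < m \<Longrightarrow> strict_trunc e (q i) = strict_trunc e (q j) \<Longrightarrow>
    trunc e (q i) \<noteq> trunc e (q j) \<Longrightarrow> x i ^ branching i e \<noteq> x j ^ branching i e"
  unfolding height_cond_def by blast

text \<open>The share of the exponent \<open>e\<close> in \<open>slope_eq_slope_iff\<close> for one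
  pair of conjugates. The premises involve \<open>Q\<close> only; the unknown \<open>x\<close>
  enters through the conclusions.\<close>

definition slope_cond :: "rat \<Rightarrow> (nat \<Rightarrow> complex) \<Rightarrow> nat \<Rightarrow> nat \<Rightarrow> nat \<Rightarrow> nat \<Rightarrow> bool" where
  "slope_cond e x i j k l \<longleftrightarrow>
    ((\<forall>e'\<ge>e. (gal ^^ k) (q i) e' = (gal ^^ l) (q j) e') \<longrightarrow> x i * zeta e ^ k = x j * zeta e ^ l) \<and>
    ((gal ^^ k) (q i) e \<noteq> (gal ^^ l) (q j) e \<and> (\<forall>e'>e. (gal ^^ k) (q i) e' = (gal ^^ l) (q j) e')
       \<longrightarrow> x i * zeta e ^ k \<noteq> x j * zeta e ^ l)"

lemma slope_cond_iff:
  "slope_cond e x i j k l \<longleftrightarrow>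
    ((gal ^^ k) (trunc e (q i)) = (gal ^^ l) (trunc e (q j)) \<longrightarrow> x i * zeta e ^ k = x j * zeta e ^ l) \<and>
    (q i e * zeta e ^ k \<noteq> q j e * zeta e ^ l \<and>
       (gal ^^ k) (strict_trunc e (q i)) = (gal ^^ l) (strict_trunc e (q j))
       \<longrightarrow> x i * zeta e ^ k \<noteq> x j * zeta e ^ l)"
  unfolding slope_cond_def gal_funpow_eq_iff_trunc gal_funpow_eq_iff_strict_trunc
  by (simp add: gal_funpow)

text \<open>If the powers agreed, \<open>x i / x j\<close> would be \<open>zeta e ^ (?R * t)\<close>
  for some \<open>t < ?N\<close>. The shift by \<open>?R * t\<close> fixes the common strict
  truncation, but compatibility keeps the full truncations apart, so a slope condition forbids
  exactly this ratio. That \<open>q j e\<close> is nonzero keeps the shift in the tested range: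
  \<open>?R * ?N\<close>, the lcm of \<open>?R\<close> and \<open>denom e\<close>, then divides
  \<open>ram (q j)\<close>.\<close>

lemma slope_cond_imp_power_neq:
  assumes ij: "i < m" "j < m" and slopes: "\<And>l. l \<le> ram (q j) \<Longrightarrow> slope_cond e x i j 0 l"
    and eq: "strict_trunc e (q i) = strict_trunc e (q j)"
    and neq: "trunc e (q i) \<noteq> trunc e (q j)" and nz: "q j e \<noteq> 0"
  shows "x i ^ branching i e \<noteq> x j ^ branching i e"
proof
  let ?R = "parent_ram i e" and ?N = "branching i e"
  assume pow: "x i ^ ?N = x j ^ ?N"
  have cond: "x i \<noteq> x j * zeta e ^ l" if l: "l \<le> ram (q j)" "?R dvd l" for l
  proof -
    have "(gal ^^ 0) (strict_trunc e (q i)) = (gal ^^ l) (strict_trunc e (q j))"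
      using gal_funpow_same_iff [OF is_ef_strict_trunc [OF is_ef [OF ij(2)]], of l e 0] l(2) eq
      by (simp add: parent_ram_def)
    moreover have "(gal ^^ 0) (trunc e (q i)) \<noteq> (gal ^^ l) (trunc e (q j))"
      using trunc_eqI [OF ij] neq by blast
    ultimately have *: "q i e * zeta e ^ 0 \<noteq> q j e * zeta e ^ l"
        "(gal ^^ 0) (strict_trunc e (q i)) = (gal ^^ l) (strict_trunc e (q j))"
      unfolding gal_funpow_trunc_eq_iff by blast+
    have "x i * zeta e ^ 0 \<noteq> x j * zeta e ^ l"
      using slopes [OF l(1)] * unfolding slope_cond_iff by blast
    then show ?thesis
      by simp
  qed
  have "x j \<noteq> 0"
  proof
    assume "x j = 0"
    then have "x i = 0"
      using pow branching_pos [OF ij(1), of e] by (simp add: zero_power)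
    then show False
      using cond [of 0] \<open>x j = 0\<close> by simp
  qed
  have "(zeta e ^ ?R) ^ t = 1 \<longleftrightarrow> ?N dvd t" for t
  proof -
    have "(zeta e ^ ?R) ^ t = 1 \<longleftrightarrow> denom e dvd ?R * t"
      by (simp add: zeta_power_eq_1_iff flip: power_mult)
    also have "\<dots> \<longleftrightarrow> lcm ?R (denom e) dvd ?R * t"
      by simp
    also have "\<dots> \<longleftrightarrow> ?N dvd t"
      using parent_ram_pos [OF ij(1), of e]
      by (simp flip: parent_ram_mult_branching [OF ij(1)])
    finally show ?thesis .
  qed
  from roots_of_unity_eq_powers [OF branching_pos [OF ij(1)] this]
  have "x i / x j \<in> (\<lambda>t. (zeta e ^ ?R) ^ t) ` {..<?N}"
    using pow \<open>x j \<noteq> 0\<close> by (auto simp: power_divide simp flip: roots_of_unity_eq_powers)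
  then obtain t where t: "t < ?N" "x i / x j = zeta e ^ (?R * t)"
    by (auto simp flip: power_mult)
  have "?R dvd ram (q j)"
    unfolding parent_ram_def eq using ram_strict_trunc_dvd ram_trunc_dvd is_ef [OF ij(2)] dvd_trans by metis
  then have "?R * ?N dvd ram (q j)"
    using denom_dvd_ram [OF is_ef [OF ij(2)] nz] by (simp add: parent_ram_mult_branching [OF ij(1)])
  then have "?R * ?N \<le> ram (q j)"
    using ram_pos [OF is_ef [OF ij(2)]] by (rule dvd_imp_le)
  then have "?R * t \<le> ram (q j)"
    using t(1) by (meson le_trans less_imp_le mult_le_mono2)
  from cond [OF this] t(2) \<open>x j \<noteq> 0\<close> show False
    by (simp add: field_simps)
qed

lemma height_cond_if_slope_cond:
  assumes slopes: "\<And>i j k l. i < m \<Longrightarrow> j < m \<Longrightarrow> k \<le> ram (q i) \<Longrightarrow> l \<le> ram (q j) \<Longrightarrow>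
    slope_cond e x i j k l"
  shows "height_cond e x"
  unfolding height_cond_def
proof (intro conjI allI impI)
  fix i j assume ij: "i < m" "j < m" "trunc e (q i) = trunc e (q j)"
  then show "x i = x j"
    using slopes [of i j 0 0] by (simp add: slope_cond_iff)
next
  fix i assume i: "i < m" "\<not> adm i e"
  \<comment> \<open>This shift fixes the truncation of \<open>q i\<close> but multiplies
    \<open>x i\<close> by a root of unity other than 1, since \<open>denom e\<close> does not divide
    it.\<close>
  let ?k = "ram (trunc e (q i))"
  have "?k \<le> ram (q i)"
    using ram_trunc_dvd ram_pos is_ef [OF i(1)] by (metis dvd_imp_le)
  moreover have "(gal ^^ ?k) (trunc e (q i)) = trunc e (q i)"
    using gal_funpow_ram [OF is_ef_trunc [OF is_ef [OF i(1)]], of e 1] by simp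
  ultimately have "x i * zeta e ^ ?k = x i"
    using slopes [of i i ?k 0] i by (simp add: slope_cond_iff)
  then show "x i = 0"
    using i(2) by (simp add: adm_def zeta_power_eq_1_iff)
next
  fix i assume i: "i < m" "adm i e \<and> \<not> denom e dvd parent_ram i e"
  \<comment> \<open>This shift fixes everything above \<open>e\<close> and moves
    \<open>q i e\<close>, so it has to move \<open>x i\<close> as well.\<close>
  let ?k = "parent_ram i e"
  have "?k dvd ram (q i)"
    unfolding parent_ram_def using ram_strict_trunc_dvd ram_trunc_dvd is_ef [OF i(1)] dvd_trans by metis
  then have "?k \<le> ram (q i)"
    using ram_pos is_ef [OF i(1)] by (metis dvd_imp_le)
  moreover have "(gal ^^ ?k) (strict_trunc e (q i)) = strict_trunc e (q i)"
    using gal_funpow_ram [OF is_ef_strict_trunc [OF is_ef [OF i(1)]], of e 1]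
    by (simp add: parent_ram_def)
  moreover have "q i e * zeta e ^ ?k \<noteq> q i e"
    using i coeff_nonzero_if_adm [of i e] by (simp add: zeta_power_eq_1_iff)
  ultimately have "x i * zeta e ^ ?k \<noteq> x i"
    using slopes [of i i ?k 0] i by (simp add: slope_cond_iff)
  then show "x i \<noteq> 0"
    by auto
next
  fix i j assume ij: "i < m" "j < m"
    and tr: "strict_trunc e (q i) = strict_trunc e (q j) \<and> trunc e (q i) \<noteq> trunc e (q j)"
  show "x i ^ branching i e \<noteq> x j ^ branching i e"
  \<comment> \<open>The coefficients of \<open>Q\<close> at \<open>e\<close> differ, so one of them
    is nonzero; exchanging \<open>i\<close> and \<open>j\<close> if necessary puts it
    second.\<close>
  proof (cases "q j e = 0")
    case False
    then show ?thesis
      using ij tr slopes by (intro slope_cond_imp_power_neq) auto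
  next
    case True
    then have "q i e \<noteq> 0"
      using tr trunc_eq_iff by metis
    then have "x j ^ branching j e \<noteq> x i ^ branching j e"
      using ij tr slopes by (intro slope_cond_imp_power_neq) auto
    moreover have "branching j e = branching i e"
      using tr by (simp add: branching_def parent_ram_def)
    ultimately show ?thesis
      by auto
  qed
qed

text \<open>The shifts are unbounded here. Agreement above \<open>e\<close> forces a common strict
  truncation and makes \<open>k - l\<close> a multiple of \<open>?R\<close>. For distinct nodes the
  \<open>?N\<close>-th power then erases the roots of unity at \<open>e\<close>; for equal nodes a
  moved coefficient means that the node is mandatory.\<close>

lemma slope_cond_if_height_cond:
  assumes x: "height_cond e x" and ij: "i < m" "j < m"
  shows "slope_cond e x i j k l"
  unfolding slope_cond_iff
proof (intro conjI impI)
  assume eq: "(gal ^^ k) (trunc e (q i)) = (gal ^^ l) (trunc e (q j))"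
  have tr: "trunc e (q i) = trunc e (q j)"
    by (rule trunc_eqI [OF ij eq])
  then have "x i = x j"
    by (rule height_cond_eq [OF x ij])
  show "x i * zeta e ^ k = x j * zeta e ^ l"
  proof (cases "adm i e")
    case True
    have "int (ram (trunc e (q i))) dvd int k - int l"
      using eq tr gal_funpow_same_iff [OF is_ef_trunc [OF is_ef [OF ij(2)]]] by simp
    then have "int (denom e) dvd int k - int l"
      using True unfolding adm_def by (meson dvd_trans int_dvd_int_iff)
    then show ?thesis
      using \<open>x i = x j\<close> by (simp add: zeta_power_eq_iff)
  next
    case False
    then show ?thesis
      using height_cond_zero [OF x ij(1)] \<open>x i = x j\<close> by simp
  qed
next
  let ?R = "parent_ram i e" and ?N = "branching i e"
  assume *: "q i e * zeta e ^ k \<noteq> q j e * zeta e ^ l \<and>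
    (gal ^^ k) (strict_trunc e (q i)) = (gal ^^ l) (strict_trunc e (q j))"
  have tr: "strict_trunc e (q i) = strict_trunc e (q j)"
    by (rule strict_trunc_eqI [OF ij]) (use * in blast)
  then have R: "int ?R dvd int k - int l"
    using * gal_funpow_same_iff [OF is_ef_strict_trunc [OF is_ef [OF ij(2)]]]
    by (simp add: parent_ram_def)
  show "x i * zeta e ^ k \<noteq> x j * zeta e ^ l"
  proof (cases "trunc e (q i) = trunc e (q j)")
    case True
    then have "q i e = q j e" "x i = x j"
      using height_cond_eq [OF x ij] by (auto simp: trunc_eq_iff)
    with * have nz: "q i e \<noteq> 0" and zeta: "zeta e ^ k \<noteq> zeta e ^ l"
      by auto
    then have "\<not> denom e dvd ?R"
      using R zeta unfolding zeta_power_eq_iff by (meson dvd_trans int_dvd_int_iff)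
    then have "x i \<noteq> 0"
      by (rule height_cond_nonzero [OF x ij(1) admI [OF ij(1) nz]])
    with zeta \<open>x i = x j\<close> show ?thesis
      by simp
  next
    case False
    then have neq: "x i ^ ?N \<noteq> x j ^ ?N"
      by (rule height_cond_power [OF x ij tr])
    have "int (?R * ?N) dvd (int k - int l) * int ?N"
      using R by (simp add: mult_dvd_mono)
    then have "int (denom e) dvd (int k - int l) * int ?N"
      by (metis dvd_lcm2 dvd_trans int_dvd_int_iff parent_ram_mult_branching [OF ij(1)])
    then have "zeta e ^ (k * ?N) = zeta e ^ (l * ?N)"
      by (simp add: zeta_power_eq_iff left_diff_distrib)
    show ?thesis
    proof
      assume "x i * zeta e ^ k = x j * zeta e ^ l"
      then have "(x i * zeta e ^ k) ^ ?N = (x j * zeta e ^ l) ^ ?N"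
        by simp
      then show False
        using neq \<open>zeta e ^ (k * ?N) = zeta e ^ (l * ?N)\<close>
        by (simp add: power_mult_distrib flip: power_mult)
    qed
  qed
qed

lemma height_cond_iff:
  "height_cond e x \<longleftrightarrow> (\<forall>i<m. \<forall>j<m. \<forall>k\<le>ram (q i). \<forall>l\<le>ram (q j). slope_cond e x i j k l)"
  by (auto intro: height_cond_if_slope_cond slope_cond_if_height_cond)

section \<open>Exponents and the coordinates of \<open>BQ\<close>\<close>

lemma bex_factor_iff: "(\<exists>p\<in>set Q. P (snd p)) \<longleftrightarrow> (\<exists>i<m. P (q i))"
  by (metis in_set_conv_nth)

lemma rQ_pos: "0 < rQ Q"
proof -
  have "0 < ram (snd p)" if "p \<in> set Q" for p
    using that is_ef ram_pos by (metis in_set_conv_nth)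
  then have "0 \<notin> (\<lambda>p. ram (snd p)) ` set Q"
    by force
  then show ?thesis
    unfolding rQ_def by (simp add: Lcm_0_iff flip: neq0_conv)
qed

lemma ram_dvd_rQ: "i < m \<Longrightarrow> ram (q i) dvd rQ Q"
  unfolding rQ_def by (intro dvd_Lcm) simp

lemma denom_dvd_rQ: "i < m \<Longrightarrow> adm i e \<Longrightarrow> denom e dvd rQ Q"
  unfolding adm_def by (meson dvd_trans is_ef ram_dvd_rQ ram_trunc_dvd)

lemma slope_le_KQ: "i < m \<Longrightarrow> slope (q i) \<le> KQ Q"
  unfolding KQ_def by (auto intro!: Max_ge)

lemma le_KQ_if_coeff: "i < m \<Longrightarrow> q i e \<noteq> 0 \<Longrightarrow> e \<le> KQ Q"
  using slope_ge [OF is_ef] slope_le_KQ by (meson order_trans)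

lemma pos_if_coeff: "i < m \<Longrightarrow> q i e \<noteq> 0 \<Longrightarrow> 0 < e"
  using is_ef by (auto simp: is_ef_def)

lemma KQ_less_eta: "KQ Q < eta Q"
  unfolding eta_def by linarith

text \<open>Above all exponents of \<open>q i\<close> the truncation is 0 with ramification 1, so an
  admissible height there is an integer, and no integer lies strictly between \<open>KQ Q\<close>
  and \<open>eta Q\<close>.\<close>

lemma le_KQ_if_adm:
  assumes i: "i < m" "adm i e" and e: "e < eta Q"
  shows "e \<le> KQ Q"
proof (cases "\<exists>k\<ge>e. q i k \<noteq> 0")
  case True
  then show ?thesis
    using le_KQ_if_coeff [OF i(1)] order_trans by blast
next
  case False
  then have "denom e dvd 1"
    using i(2) ram_dvd_iff [OF is_ef_trunc [OF is_ef [OF i(1)]], of e 1]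
    by (auto simp: adm_def trunc_apply split: if_splits)
  then have "e \<in> \<int>"
    using denom_eq_1_iff by simp
  then obtain n where "e = of_int n"
    by (auto elim: Ints_cases)
  then have "(of_int n :: rat) < of_int (\<lfloor>KQ Q\<rfloor> + 1)"
    using e by (simp add: eta_def)
  then have "n \<le> \<lfloor>KQ Q\<rfloor>"
    unfolding of_int_less_iff by simp
  then show ?thesis
    using \<open>e = of_int n\<close> by (simp add: le_floor_iff)
qed

text \<open>Such an \<open>e\<close> is a multiple of \<open>1 / rQ Q\<close>; as its numerator is
  an integer, the floor in \<open>sQ\<close> loses nothing.\<close>

lemma ex_exponent_index:
  assumes "denom e dvd rQ Q" "0 < e" "e \<le> KQ Q"
  obtains j where "1 \<le> j" "j \<le> sQ Q" "e = of_nat j / of_nat (rQ Q)"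
proof -
  obtain j :: nat where j: "e = of_nat j / of_nat (rQ Q)"
    using assms eq_divide_of_nat_iff_denom_dvd rQ_pos by metis
  have "1 \<le> j"
    using assms(2) j by (cases j) auto
  have "of_nat j = of_nat (rQ Q) * e"
    using j rQ_pos by simp
  also have "\<dots> \<le> of_nat (rQ Q) * KQ Q"
    using assms(3) by (intro mult_left_mono) auto
  finally have "int j \<le> \<lfloor>of_nat (rQ Q) * KQ Q\<rfloor>"
    by (simp add: le_floor_iff)
  then have "j \<le> sQ Q"
    by (simp add: sQ_def)
  with \<open>1 \<le> j\<close> j show ?thesis
    using that by blast
qed

lemma exponent_le_KQ:
  assumes "1 \<le> j" "j \<le> sQ Q"
  shows "of_nat j / of_nat (rQ Q) \<le> KQ Q"
proof -
  have "int j \<le> \<lfloor>of_nat (rQ Q) * KQ Q\<rfloor>"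
    using assms by (simp add: sQ_def)
  then have "of_nat j \<le> of_nat (rQ Q) * KQ Q"
    by (simp add: le_floor_iff)
  then show ?thesis
    using rQ_pos by (simp add: field_simps)
qed

lemma floor_exponent: "nat \<lfloor>of_nat j / of_nat (rQ Q) * (of_nat (rQ Q) :: rat)\<rfloor> = j"
  using rQ_pos by simp

definition coeff :: "(nat \<times> nat \<Rightarrow> complex) \<Rightarrow> nat \<Rightarrow> rat \<Rightarrow> complex" where
  "coeff a i e = (if \<exists>j\<in>{1..sQ Q}. e = of_nat j / of_nat (rQ Q)
     then a (i, nat \<lfloor>e * of_nat (rQ Q)\<rfloor>) else 0)"

lemma snd_Qa: "i < m \<Longrightarrow> snd (Qa Q a ! i) = coeff a i"
  by (simp add: Qa_def coeff_def fun_eq_iff)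

lemma coeff_at:
  assumes "1 \<le> j" "j \<le> sQ Q"
  shows "coeff a i (of_nat j / of_nat (rQ Q)) = a (i, j)"
  unfolding coeff_def floor_exponent using assms by auto

lemma coeff_adm:
  assumes "i < m" "adm i e" "0 < e" "e \<le> KQ Q"
  shows "coeff a i' e = a (i', nat \<lfloor>e * of_nat (rQ Q)\<rfloor>)"
proof -
  obtain j where "1 \<le> j" "j \<le> sQ Q" "e = of_nat j / of_nat (rQ Q)"
    using ex_exponent_index [OF denom_dvd_rQ [OF assms(1,2)] assms(3,4)] .
  then show ?thesis
    unfolding coeff_def by auto
qed

lemma is_ef_coeff: "is_ef (coeff a i)"
proof -
  have "{k. coeff a i k \<noteq> 0} \<subseteq> (\<lambda>j. of_nat j / of_nat (rQ Q)) ` {1..sQ Q}"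
    by (auto simp: coeff_def split: if_splits)
  then have "finite {k. coeff a i k \<noteq> 0}"
    by (rule finite_subset) simp
  moreover have "0 < k" if "coeff a i k \<noteq> 0" for k
    using that rQ_pos by (auto simp: coeff_def split: if_splits)
  ultimately show ?thesis
    by (simp add: is_ef_def)
qed

text \<open>For fixed indices and shifts the equality of slopes splits over the exponents.
  Exchanging quantifiers collects all pairs and shifts at each \<open>e\<close>, which is
  \<open>height_cond\<close>.\<close>

lemma mem_BQ_iff:
  "a \<in> BQ Q \<longleftrightarrow> (\<forall>i j. a (i, j) \<noteq> 0 \<longrightarrow> i < m \<and> 1 \<le> j \<and> j \<le> sQ Q) \<and>
     (\<forall>e>0. height_cond e (\<lambda>i. coeff a i e))"
proof -
  have "(slope (\<lambda>x. (gal ^^ k) (snd (Qa Q a ! i)) x - (gal ^^ l) (snd (Qa Q a ! j)) x) =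
         slope (\<lambda>x. (gal ^^ k) (q i) x - (gal ^^ l) (q j) x)) \<longleftrightarrow>
        (\<forall>e>0. slope_cond e (\<lambda>i. coeff a i e) i j k l)" if "i < m" "j < m" for i j k l
    unfolding snd_Qa [OF that(1)] snd_Qa [OF that(2)]
      slope_eq_slope_iff [OF is_ef_diff_gal [OF is_ef_coeff is_ef_coeff]
        is_ef_diff_gal [OF is_ef [OF that(1)] is_ef [OF that(2)]]] slope_cond_def
    by (simp add: gal_funpow)
  then have "pit_equiv (Qa Q a) Q \<longleftrightarrow> (\<forall>i<m. \<forall>j<m. \<forall>k\<le>ram (q i). \<forall>l\<le>ram (q j). \<forall>e>0.
      slope_cond e (\<lambda>i. coeff a i e) i j k l)"
    unfolding pit_equiv_def by (simp add: Qa_def)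
  also have "\<dots> \<longleftrightarrow> (\<forall>e>0. height_cond e (\<lambda>i. coeff a i e))"
    unfolding height_cond_iff by blast
  finally show ?thesis
    unfolding BQ_def by blast
qed

lemma BQ_height_cond: "a \<in> BQ Q \<Longrightarrow> 0 < e \<Longrightarrow> height_cond e (\<lambda>i. coeff a i e)"
  unfolding mem_BQ_iff by blast

text \<open>The exponents of \<open>q i\<close> are multiples of \<open>1 / rQ Q\<close> not
  exceeding \<open>KQ Q\<close>, so \<open>Qa\<close> recovers each \<open>q i\<close> without
  loss.\<close>

lemma baseQ_in_BQ: "baseQ Q \<in> BQ Q"
proof -
  have "coeff (baseQ Q) i e = q i e" if i: "i < m" for i e
  proof (cases "\<exists>j\<in>{1..sQ Q}. e = of_nat j / of_nat (rQ Q)")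
    case True
    then show ?thesis
      using coeff_at i by (auto simp: baseQ_def)
  next
    case False
    then have "q i e = 0"
      using ex_exponent_index [of e] denom_dvd_rQ [OF i admI [OF i]] pos_if_coeff [OF i]
        le_KQ_if_coeff [OF i] by (metis atLeastAtMost_iff)
    with False show ?thesis
      by (simp add: coeff_def)
  qed
  then have "snd (Qa Q (baseQ Q) ! i) = q i" if "i < m" for i
    using that by (simp add: snd_Qa fun_eq_iff)
  then have "pit_equiv (Qa Q (baseQ Q)) Q"
    unfolding pit_equiv_def by (simp add: Qa_def)
  then show ?thesis
    unfolding BQ_def baseQ_def by auto
qed

section \<open>The fission tree\<close>

lemma mem_AQ_iff: "e \<in> AQ Q \<longleftrightarrow> 0 < e \<and> (\<exists>i<m. adm i e)"
proof -
  have "e \<in> AQ Q \<longleftrightarrow> (\<exists>i<m. e \<in> Aset (levels (q i)))"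
    unfolding AQ_def UN_iff by (rule bex_factor_iff)
  then show ?thesis
    using mem_Aset_levels_iff [OF is_ef] unfolding adm_def by blast
qed

text \<open>Denominators of heights divide \<open>rQ Q\<close>. Although \<open>AQ Q\<close> is
  unbounded once \<open>Q\<close> is nonempty, bounded parts are finite, so the \<open>Max\<close>
  in \<open>prevh\<close> and a next larger height make sense.\<close>

lemma finite_AQ_atMost: "finite {e \<in> AQ Q. e \<le> c}"
proof (rule finite_subset)
  show "{e \<in> AQ Q. e \<le> c} \<subseteq> (\<lambda>j. of_nat j / of_nat (rQ Q)) ` {..nat \<lfloor>of_nat (rQ Q) * c\<rfloor>}"
  proof
    fix e assume e: "e \<in> {e \<in> AQ Q. e \<le> c}"
    then have "denom e dvd rQ Q" "0 < e"
      using denom_dvd_rQ by (auto simp: mem_AQ_iff)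
    then obtain j :: nat where j: "e = of_nat j / of_nat (rQ Q)"
      using eq_divide_of_nat_iff_denom_dvd rQ_pos by metis
    then have "of_nat j = of_nat (rQ Q) * e"
      using rQ_pos by simp
    also have "\<dots> \<le> of_nat (rQ Q) * c"
      using e by (intro mult_left_mono) auto
    finally have "of_nat j \<le> of_nat (rQ Q) * c" .
    then have "int j \<le> \<lfloor>of_nat (rQ Q) * c\<rfloor>"
      by (simp add: le_floor_iff)
    then have "j \<le> nat \<lfloor>of_nat (rQ Q) * c\<rfloor>"
      by simp
    with j show "e \<in> (\<lambda>j. of_nat j / of_nat (rQ Q)) ` {..nat \<lfloor>of_nat (rQ Q) * c\<rfloor>}"
      by auto
  qed
qed simp

lemma eta_in_AQ:
  assumes "i < m"
  shows "eta Q \<in> AQ Q"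
proof -
  have "0 \<le> slope (q i)"
  proof (cases "slope (q i) = 0")
    case False
    then have "q i (slope (q i)) \<noteq> 0"
      using slope_eq_nonzero_iff [OF is_ef [OF assms]] by blast
    then show ?thesis
      using pos_if_coeff [OF assms] by force
  qed simp
  then have "0 < eta Q"
    using slope_le_KQ [OF assms] KQ_less_eta by linarith
  moreover have "denom (eta Q) = 1"
    unfolding denom_eq_1_iff by (simp add: eta_def)
  ultimately show ?thesis
    using assms by (auto simp: mem_AQ_iff adm_def)
qed

text \<open>Unlike \<open>prevh\<close>, which is a \<open>Max\<close> of a possibly empty set, the
  relation records that a lower height exists, and it can also be read upwards from child to
  parent.\<close>

definition covers :: "rat \<Rightarrow> rat \<Rightarrow> bool" where
  "covers k e \<longleftrightarrow> k \<in> AQ Q \<and> e \<in> AQ Q \<and> e < k \<and> (\<forall>x\<in>AQ Q. x \<le> e \<or> k \<le> x)"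

lemma prevh_covers:
  assumes "k \<in> AQ Q" "{k' \<in> AQ Q. k' < k} \<noteq> {}"
  shows "covers k (prevh Q k)"
proof -
  have "finite {k' \<in> AQ Q. k' < k}"
    by (rule finite_subset [OF _ finite_AQ_atMost [of k]]) auto
  from Max_in [OF this assms(2)] Max_ge [OF this] show ?thesis
    unfolding covers_def prevh_def using assms(1) by (fastforce simp: not_le)
qed

lemma covers_unique:
  "covers k e \<Longrightarrow> covers k e' \<Longrightarrow> e = e'" "covers k e \<Longrightarrow> covers k' e \<Longrightarrow> k = k'"
  unfolding covers_def by (metis order_antisym leD)+

lemma covers_imp_prevh:
  assumes "covers k e"
  shows "{k' \<in> AQ Q. k' < k} \<noteq> {}" "prevh Q k = e"
proof -
  show *: "{k' \<in> AQ Q. k' < k} \<noteq> {}"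
    using assms by (auto simp: covers_def)
  have "k \<in> AQ Q"
    using assms by (simp add: covers_def)
  then show "prevh Q k = e"
    using prevh_covers [OF _ *] assms covers_unique(1) by blast
qed

lemma ex_covers:
  assumes e: "e \<in> AQ Q" "e < eta Q"
  obtains k where "covers k e" "k \<le> eta Q"
proof -
  let ?U = "{k \<in> AQ Q. e < k \<and> k \<le> eta Q}"
  have fin: "finite ?U"
    by (rule finite_subset [OF _ finite_AQ_atMost [of "eta Q"]]) auto
  have ne: "?U \<noteq> {}"
    using e eta_in_AQ by (auto simp: mem_AQ_iff)
  define k where "k = Min ?U"
  have k: "k \<in> ?U" "\<And>x. x \<in> ?U \<Longrightarrow> k \<le> x"
    using Min_in [OF fin ne] Min_le [OF fin] unfolding k_def by blast+
  have "x \<le> e \<or> k \<le> x" if "x \<in> AQ Q" for x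
    using k that by (cases "x \<le> eta Q") force+
  with k e that show ?thesis
    unfolding covers_def by blast
qed

text \<open>Each exponent of \<open>q i\<close> is itself an admissible height, so none lies
  strictly between \<open>e\<close> and \<open>k\<close>.\<close>

lemma covers_strict_trunc:
  assumes "covers k e" "i < m"
  shows "strict_trunc e (q i) = trunc k (q i)"
proof
  fix x
  show "strict_trunc e (q i) x = trunc k (q i) x"
  proof (cases "q i x = 0")
    case False
    then have "x \<in> AQ Q"
      using admI [OF assms(2)] pos_if_coeff [OF assms(2)] assms(2) by (auto simp: mem_AQ_iff)
    then have "(x \<le> e \<or> k \<le> x) \<and> e < k"
      using assms(1) by (simp add: covers_def)
    then show ?thesis
      by (auto simp: strict_trunc_apply trunc_apply)
  qed (simp add: strict_trunc_apply trunc_apply)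
qed

section \<open>Nodes and admissible children\<close>

lemma circ_trunc_eq_iff:
  assumes "i < m" "j < m"
  shows "circ (trunc e (q i)) = circ (trunc e (q j)) \<longleftrightarrow> trunc e (q i) = trunc e (q j)"
  using compatible assms by (auto simp: compatible_def)

lemma node_eq_iff:
  assumes "i < m" "j < m"
  shows "node i e = node j e' \<longleftrightarrow> e = e' \<and> trunc e (q i) = trunc e (q j)"
  using circ_trunc_eq_iff [OF assms] by (auto simp: node_def)

text \<open>By definition any factor through the node may serve as witness; since admissibility
  depends on the truncation only, \<open>q i\<close> decides it.\<close>

lemma admissible_node:
  assumes "i < m"
  shows "admissible Q (node i e) \<longleftrightarrow> 0 < e \<and> adm i e"
proof -
  have "admissible Q (node i e) \<longleftrightarrow>
      (\<exists>j<m. circ (trunc e (q i)) = circ (trunc e (q j)) \<and> e \<in> Aset (levels (q j)))"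
    unfolding admissible_def node_def fst_conv snd_conv by (rule bex_factor_iff)
  also have "\<dots> \<longleftrightarrow> (\<exists>j<m. trunc e (q i) = trunc e (q j) \<and> 0 < e \<and> adm j e)"
    using circ_trunc_eq_iff [OF assms] mem_Aset_levels_iff [OF is_ef] unfolding adm_def by blast
  also have "\<dots> \<longleftrightarrow> 0 < e \<and> adm i e"
    using assms unfolding adm_def by metis
  finally show ?thesis .
qed

lemma mandatory_node:
  assumes "i < m"
  shows "mandatory Q (node i e) \<longleftrightarrow> adm i e \<and> \<not> denom e dvd parent_ram i e"
proof -
  have "mandatory Q (node i e) \<longleftrightarrow>
      (\<exists>j<m. circ (trunc e (q i)) = circ (trunc e (q j)) \<and> e \<in> levels (q j))"
    unfolding mandatory_def node_def fst_conv snd_conv by (rule bex_factor_iff)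
  also have "\<dots> \<longleftrightarrow> (\<exists>j<m. trunc e (q i) = trunc e (q j) \<and> q j e \<noteq> 0 \<and> \<not> denom e dvd parent_ram j e)"
    using circ_trunc_eq_iff [OF assms] mem_levels_iff [OF is_ef] unfolding parent_ram_def by blast
  also have "\<dots> \<longleftrightarrow> q i e \<noteq> 0 \<and> \<not> denom e dvd parent_ram i e"
    using assms unfolding parent_ram_def trunc_eq_iff by metis
  also have "\<dots> \<longleftrightarrow> adm i e \<and> \<not> denom e dvd parent_ram i e"
    using admI [OF assms] coeff_nonzero_if_adm [OF assms] by blast
  finally show ?thesis .
qed

lemma mem_Vflat_iff: "v \<in> Vflat Q \<longleftrightarrow> (\<exists>i<m. \<exists>k. v = node i k \<and> k \<in> AQ Q \<and> k \<le> eta Q)"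
proof -
  have "v \<in> Vflat Q \<longleftrightarrow> (\<exists>p\<in>set Q. \<exists>k. v = (k, circ (trunc k (snd p))) \<and> k \<in> AQ Q \<and> k \<le> eta Q)"
    unfolding Vflat_def using mem_AQ_iff by blast
  also have "\<dots> \<longleftrightarrow> (\<exists>i<m. \<exists>k. v = node i k \<and> k \<in> AQ Q \<and> k \<le> eta Q)"
    unfolding node_def by (rule bex_factor_iff)
  finally show ?thesis .
qed

lemma mem_ChA_iff:
  assumes "i < m" "k \<in> AQ Q"
  shows "w \<in> ChA Q (node i k) \<longleftrightarrow>
    (\<exists>j<m. \<exists>e. covers k e \<and> w = node j e \<and> trunc k (q j) = trunc k (q i) \<and> adm j e)"
proof -
  have "w \<in> children Q (node i k) \<longleftrightarrow> (\<exists>p\<in>set Q. {k' \<in> AQ Q. k' < k} \<noteq> {} \<and>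
      w = (prevh Q k, circ (trunc (prevh Q k) (snd p))) \<and> circ (trunc k (snd p)) = circ (trunc k (q i)))"
  proof (cases "{k' \<in> AQ Q. k' < k} = {}")
    case True
    then show ?thesis
      by (simp add: children_def node_def)
  next
    case False
    have "children Q (node i k) = {(prevh Q k, circ (trunc (prevh Q k) (snd p))) | p.
        p \<in> set Q \<and> circ (trunc k (snd p)) = circ (trunc k (q i))}"
      unfolding children_def node_def fst_conv snd_conv by (rule if_not_P [OF False])
    with False show ?thesis
      by blast
  qed
  also have "\<dots> \<longleftrightarrow> (\<exists>j<m. {k' \<in> AQ Q. k' < k} \<noteq> {} \<and>
      w = node j (prevh Q k) \<and> circ (trunc k (q j)) = circ (trunc k (q i)))"
    unfolding node_def by (rule bex_factor_iff)
  also have "\<dots> \<longleftrightarrow> (\<exists>j<m. \<exists>e. covers k e \<and> w = node j e \<and> trunc k (q j) = trunc k (q i))"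
  proof -
    have "({k' \<in> AQ Q. k' < k} \<noteq> {} \<and> w = node j (prevh Q k)) \<longleftrightarrow> (\<exists>e. covers k e \<and> w = node j e)" for j
    proof
      assume "{k' \<in> AQ Q. k' < k} \<noteq> {} \<and> w = node j (prevh Q k)"
      then show "\<exists>e. covers k e \<and> w = node j e"
        using prevh_covers [OF assms(2)] by (intro exI [of _ "prevh Q k"]) simp
    next
      assume "\<exists>e. covers k e \<and> w = node j e"
      then obtain e where "covers k e" "w = node j e"
        by blast
      then show "{k' \<in> AQ Q. k' < k} \<noteq> {} \<and> w = node j (prevh Q k)"
        using covers_imp_prevh [of k e] by simp
    qed
    then have "({k' \<in> AQ Q. k' < k} \<noteq> {} \<and> w = node j (prevh Q k) \<and>
        circ (trunc k (q j)) = circ (trunc k (q i))) \<longleftrightarrow>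
        (\<exists>e. covers k e \<and> w = node j e \<and> trunc k (q j) = trunc k (q i))" if "j < m" for j
      using circ_trunc_eq_iff [OF that assms(1), of k] by blast
    then show ?thesis
      by (intro ex_cong1 conj_cong refl)
  qed
  finally have "w \<in> ChA Q (node i k) \<longleftrightarrow> (\<exists>j<m. \<exists>e. covers k e \<and> w = node j e \<and>
      trunc k (q j) = trunc k (q i)) \<and> admissible Q w"
    unfolding ChA_def by blast
  moreover have "admissible Q (node j e) \<longleftrightarrow> adm j e" if "j < m" "covers k e" for j e
    using that admissible_node [OF that(1), of e] by (simp add: covers_def mem_AQ_iff)
  ultimately show ?thesis
    by metis
qed

text \<open>\<open>RamN\<close> evaluates an arbitrary member of the circle, and conjugates have
  equal ramification.\<close>

lemma Nv_node:
  assumes "i < m" "covers k e"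
  shows "Nv Q (node i k) = branching i e"
proof -
  have "RamN (node i k) = parent_ram i e"
    unfolding RamN_def node_def parent_ram_def covers_strict_trunc [OF assms(2,1)]
    by (simp add: ram_SOME_circ is_ef_trunc is_ef assms)
  then show ?thesis
    using covers_imp_prevh(2) [OF assms(2)] by (simp add: Nv_def branching_def node_def)
qed

text \<open>Denominators are positive whatever value \<open>prevh\<close> takes, so a node with no
  height below it is covered too.\<close>

lemma Nv_pos:
  assumes "v \<in> Vflat Q"
  shows "0 < Nv Q v"
proof -
  obtain i k where i: "i < m" "v = node i k"
    using assms by (auto simp: mem_Vflat_iff)
  have "0 < RamN v"
    unfolding RamN_def i node_def using i by (simp add: ram_SOME_circ ram_pos is_ef_trunc is_ef)
  then show ?thesis
    unfolding Nv_def using denom_pos [of "prevh Q (fst v)"]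
    by (simp add: div_greater_zero_iff dvd_imp_le lcm_pos_nat)
qed

lemma Bv_eq_avoid_space: "Bv Q v = avoid_space (ChA Q v) {w. mandatory Q w} (Nv Q v)"
  by (simp add: Bv_def avoid_space_def)

lemma finite_ChA: "finite (ChA Q v)"
proof (rule finite_subset)
  show "ChA Q v \<subseteq> (\<lambda>p. (prevh Q (fst v), circ (trunc (prevh Q (fst v)) (snd p)))) ` set Q"
    by (auto simp: ChA_def children_def split: if_splits intro: rev_image_eqI)
qed simp

lemma path_connected_Bv: "path_connected (Bv Q v)"
  unfolding Bv_eq_avoid_space by (rule path_connected_avoid_space [OF finite_ChA])

text \<open>Siblings share their height and strict truncation, so whether an admissible child is
  mandatory depends on the parent alone.\<close>

lemma ChA_mandatory_cases:
  assumes "v \<in> Vflat Q"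
  shows "ChA Q v \<inter> {w. mandatory Q w} = {} \<and> Nv Q v = 1 \<or> ChA Q v \<subseteq> {w. mandatory Q w}"
proof -
  obtain i k where i: "i < m" "k \<in> AQ Q" "v = node i k"
    using assms by (auto simp: mem_Vflat_iff)
  show ?thesis
  proof (cases "\<exists>e. covers k e")
    case False
    \<comment> \<open>Without a lower height the inclusion into the mandatory nodes is vacuous, and
      \<open>Bv\<close> is a point.\<close>
    then have "ChA Q v = {}"
      using mem_ChA_iff [OF i(1,2)] i(3) by blast
    then show ?thesis
      by simp
  next
    case True
    then obtain e where e: "covers k e" ..
    have *: "mandatory Q w \<longleftrightarrow> \<not> denom e dvd parent_ram i e" if w: "w \<in> ChA Q v" for w
    proof -
      obtain j e' where j: "j < m" "covers k e'" "w = node j e'" "trunc k (q j) = trunc k (q i)" "adm j e'"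
        using w mem_ChA_iff [OF i(1,2)] i(3) by blast
      have "e' = e"
        using covers_unique(1) [OF e j(2)] by simp
      moreover have "parent_ram j e = parent_ram i e"
        unfolding parent_ram_def using covers_strict_trunc [OF e] i(1) j(1,4) by simp
      ultimately show ?thesis
        using mandatory_node [OF j(1)] j(3,5) by simp
    qed
    show ?thesis
    proof (cases "denom e dvd parent_ram i e")
      case True
      then have "Nv Q v = 1"
        using branching_eq_1_iff [OF i(1)] Nv_node [OF i(1) e] i(3) by simp
      with True * show ?thesis
        by blast
    next
      case False
      with * show ?thesis
        by blast
    qed
  qed
qed

text \<open>The child's height determines the parent's through \<open>covers\<close>, and the
  child's truncation contains that of the parent.\<close>

lemma ChA_parent_unique:
  assumes "v \<in> Vflat Q" "v' \<in> Vflat Q" "w \<in> ChA Q v" "w \<in> ChA Q v'"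
  shows "v = v'"
proof -
  obtain i k where i: "i < m" "k \<in> AQ Q" "v = node i k"
    using assms(1) by (auto simp: mem_Vflat_iff)
  obtain i' k' where i': "i' < m" "k' \<in> AQ Q" "v' = node i' k'"
    using assms(2) by (auto simp: mem_Vflat_iff)
  obtain j e where j: "j < m" "covers k e" "w = node j e" "trunc k (q j) = trunc k (q i)"
    using assms(3) mem_ChA_iff [OF i(1,2)] i(3) by blast
  obtain j' e' where j': "j' < m" "covers k' e'" "w = node j' e'" "trunc k' (q j') = trunc k' (q i')"
    using assms(4) mem_ChA_iff [OF i'(1,2)] i'(3) by blast
  have e: "e = e'" "trunc e (q j) = trunc e (q j')"
    using trans [OF j(3) [symmetric] j'(3)] unfolding node_eq_iff [OF j(1) j'(1)] by auto
  then have k: "k = k'"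
    using covers_unique(2) j(2) j'(2) by blast
  have "trunc k (q j) = trunc k (q j')"
    using e(2) covers_strict_trunc [OF j(2) j(1)] covers_strict_trunc [OF j(2) j'(1)]
    by (simp add: trunc_eq_iff)
  then show ?thesis
    using i(3) i'(3) j(4) j'(4) k node_eq_iff [OF i(1) i'(1)] by simp
qed

lemma ex_parent:
  assumes "i < m" "adm i e" "0 < e" "e \<le> KQ Q"
  obtains k where "covers k e" "node i k \<in> Vflat Q" "node i e \<in> ChA Q (node i k)"
proof -
  have "e \<in> AQ Q"
    using assms by (auto simp: mem_AQ_iff)
  then obtain k where k: "covers k e" "k \<le> eta Q"
    using ex_covers assms(4) KQ_less_eta by (metis order_le_less_trans)
  have "k \<in> AQ Q"
    using k by (simp add: covers_def)
  then have "node i k \<in> Vflat Q" "node i e \<in> ChA Q (node i k)"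
    using assms(1,2) k by (auto simp: mem_Vflat_iff mem_ChA_iff)
  with k that show ?thesis
    by blast
qed

text \<open>The index is taken from the child: its truncation at \<open>k\<close> is the parent's,
  so one \<open>i\<close> describes both nodes.\<close>

lemma ChA_D:
  assumes "v \<in> Vflat Q" "w \<in> ChA Q v"
  obtains i k e where "i < m" "covers k e" "v = node i k" "w = node i e" "adm i e" "0 < e" "e \<le> KQ Q"
proof -
  obtain i k where i: "i < m" "k \<in> AQ Q" "v = node i k" "k \<le> eta Q"
    using assms(1) by (auto simp: mem_Vflat_iff)
  obtain j e where j: "j < m" "covers k e" "w = node j e" "trunc k (q j) = trunc k (q i)" "adm j e"
    using assms(2) mem_ChA_iff [OF i(1,2)] i(3) by blast
  have "0 < e" "e < eta Q"
    using j(2) i(4) by (auto simp: covers_def mem_AQ_iff)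
  moreover have "v = node j k"
    using node_eq_iff [OF i(1) j(1)] i(3) j(4) by simp
  ultimately show ?thesis
    using that j le_KQ_if_adm by blast
qed

section \<open>Coefficient vectors versus functions on the tree\<close>

definition parent :: "node \<Rightarrow> node" where
  "parent w = (SOME v. v \<in> Vflat Q \<and> w \<in> ChA Q v)"

lemma parent_eq:
  assumes "v \<in> Vflat Q" "w \<in> ChA Q v"
  shows "parent w = v"
  unfolding parent_def
proof (rule some_equality)
  show "v' = v" if "v' \<in> Vflat Q \<and> w \<in> ChA Q v'" for v'
    using that assms ChA_parent_unique by blast
qed (use assms in blast)

definition node_index :: "node \<Rightarrow> nat" where
  "node_index w = (SOME i. i < m \<and> w = node i (fst w))"

lemma node_index:
  assumes "i < m"
  shows "node_index (node i e) < m" "trunc e (q (node_index (node i e))) = trunc e (q i)"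
    "node (node_index (node i e)) e = node i e"
proof -
  have *: "node_index (node i e) < m \<and> node i e = node (node_index (node i e)) (fst (node i e))"
    unfolding node_index_def by (rule someI [of _ i]) (simp add: assms node_def)
  then show "node_index (node i e) < m" "node (node_index (node i e)) e = node i e"
    by (simp_all add: node_def)
  then show "trunc e (q (node_index (node i e))) = trunc e (q i)"
    using node_eq_iff [OF _ assms] by simp
qed

text \<open>The coefficient is read from an arbitrarily chosen factor through \<open>w\<close>; on
  \<open>BQ Q\<close> the choice is immaterial by \<open>to_tree_node_BQ\<close>.\<close>

definition to_tree :: "node \<Rightarrow> (nat \<times> nat \<Rightarrow> complex) \<Rightarrow> node \<Rightarrow> complex" where
  "to_tree v a w = (if w \<in> ChA Q v then a (node_index w, nat \<lfloor>fst w * of_nat (rQ Q)\<rfloor>) else 0)"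

text \<open>The inverse that \<open>height_cond\<close> dictates: factors through one node share a
  coefficient, and non-admissible positions carry 0.\<close>

definition of_tree :: "(node \<Rightarrow> node \<Rightarrow> complex) \<Rightarrow> nat \<times> nat \<Rightarrow> complex" where
  "of_tree c = (\<lambda>(i, j). let w = node i (of_nat j / of_nat (rQ Q)) in
     if i < m \<and> 1 \<le> j \<and> j \<le> sQ Q \<and> adm i (of_nat j / of_nat (rQ Q)) then c (parent w) w else 0)"

lemma to_tree_node:
  assumes "i < m" "adm i e" "0 < e" "e \<le> KQ Q" "node i e \<in> ChA Q v"
  shows "to_tree v a (node i e) = coeff a (node_index (node i e)) e"
  using assms coeff_adm [OF assms(1-4)] by (simp add: to_tree_def) (simp add: node_def)

lemma to_tree_node_BQ:
  assumes "a \<in> BQ Q" "i < m" "adm i e" "0 < e" "e \<le> KQ Q" "node i e \<in> ChA Q v"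
  shows "to_tree v a (node i e) = coeff a i e"
  unfolding to_tree_node [OF assms(2-6)]
  by (rule height_cond_eq [OF BQ_height_cond [OF assms(1,4)] node_index(1) assms(2) node_index(2)])
    (rule assms(2))+

lemma coeff_of_tree:
  assumes "i < m" "0 < e"
  shows "coeff (of_tree c) i e =
    (if e \<le> KQ Q \<and> adm i e then c (parent (node i e)) (node i e) else 0)"
proof (cases "\<exists>j\<in>{1..sQ Q}. e = of_nat j / of_nat (rQ Q)")
  case True
  then obtain j where j: "1 \<le> j" "j \<le> sQ Q" "e = of_nat j / of_nat (rQ Q)"
    by auto
  then show ?thesis
    using exponent_le_KQ [OF j(1,2)] coeff_at [OF j(1,2)] assms by (simp add: of_tree_def Let_def)
next
  case False
  then have not_adm: "\<not> (e \<le> KQ Q \<and> adm i e)"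
    using ex_exponent_index [of e] denom_dvd_rQ [OF assms(1)] assms(2) by (metis atLeastAtMost_iff)
  show ?thesis
    unfolding coeff_def if_not_P [OF False] if_not_P [OF not_adm] ..
qed

lemma to_tree_in_Bv:
  assumes a: "a \<in> BQ Q" and v: "v \<in> Vflat Q"
  shows "to_tree v a \<in> Bv Q v"
  unfolding Bv_def
proof (intro CollectI conjI allI impI ballI)
  fix w assume w: "w \<in> ChA Q v" "mandatory Q w"
  obtain i k e where i: "i < m" "covers k e" "v = node i k" "w = node i e" "adm i e" "0 < e" "e \<le> KQ Q"
    by (rule ChA_D [OF v w(1)])
  then have "coeff a i e \<noteq> 0"
    using height_cond_nonzero [OF BQ_height_cond [OF a i(6)] i(1,5)] w(2) mandatory_node by blast
  then show "to_tree v a w \<noteq> 0"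
    using to_tree_node_BQ [OF a i(1,5-7)] w(1) i(4) by simp
next
  fix u w assume uw: "u \<in> ChA Q v" "w \<in> ChA Q v" "u \<noteq> w"
  obtain i k e where i: "i < m" "covers k e" "v = node i k" "u = node i e" "adm i e" "0 < e" "e \<le> KQ Q"
    by (rule ChA_D [OF v uw(1)])
  obtain j k' e' where j: "j < m" "covers k' e'" "v = node j k'" "w = node j e'" "adm j e'" "0 < e'" "e' \<le> KQ Q"
    by (rule ChA_D [OF v uw(2)])
  have k: "k = k'" "trunc k (q i) = trunc k (q j)"
    using trans [OF i(3) [symmetric] j(3)] unfolding node_eq_iff [OF i(1) j(1)] by auto
  then have e: "e' = e"
    using covers_unique(1) i(2) j(2) by blast
  have "coeff a i e ^ branching i e \<noteq> coeff a j e ^ branching i e"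
  proof (rule height_cond_power [OF BQ_height_cond [OF a i(6)] i(1) j(1)])
    show "strict_trunc e (q i) = strict_trunc e (q j)"
      using k(2) covers_strict_trunc [OF i(2)] i(1) j(1) by simp
    show "trunc e (q i) \<noteq> trunc e (q j)"
      using uw(3) i(4) j(4) e node_eq_iff [OF i(1) j(1)] by simp
  qed
  then show "to_tree v a u ^ Nv Q v \<noteq> to_tree v a w ^ Nv Q v"
    using to_tree_node_BQ [OF a i(1,5-7)] to_tree_node_BQ [OF a j(1,5-7)] uw i(3,4) j(4) e
      Nv_node [OF i(1,2)] by simp
qed (simp add: to_tree_def)

lemma of_tree_in_BQ:
  assumes c: "\<And>v. v \<in> Vflat Q \<Longrightarrow> c v \<in> Bv Q v"
  shows "of_tree c \<in> BQ Q"
  unfolding mem_BQ_iff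
proof (intro conjI allI impI)
  show "i < m" "1 \<le> j" "j \<le> sQ Q" if "of_tree c (i, j) \<noteq> 0" for i j
    using that by (auto simp: of_tree_def Let_def split: if_splits)
next
  fix e :: rat assume e: "0 < e"
  define x where "x i = coeff (of_tree c) i e" for i
  have x: "x i = (if e \<le> KQ Q \<and> adm i e then c (parent (node i e)) (node i e) else 0)" if "i < m" for i
    unfolding x_def by (rule coeff_of_tree [OF that e])
  have nonzero: "x i \<noteq> 0" if i: "i < m" "adm i e" "\<not> denom e dvd parent_ram i e" for i
  proof -
    \<comment> \<open>A mandatory node has a nonzero coefficient in \<open>Q\<close>, which bounds
      \<open>e\<close> and so provides a parent in \<open>Vflat Q\<close>.\<close>
    have K: "e \<le> KQ Q"
      using coeff_nonzero_if_adm [OF i] le_KQ_if_coeff i(1) by blast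
    obtain k where k: "covers k e" "node i k \<in> Vflat Q" "node i e \<in> ChA Q (node i k)"
      by (rule ex_parent [OF i(1,2) e K])
    have "c (node i k) (node i e) \<noteq> 0"
      using c [OF k(2)] k(3) mandatory_node [OF i(1)] i(2,3) by (simp add: Bv_def)
    then show ?thesis
      using x [OF i(1)] K i(2) parent_eq [OF k(2,3)] by simp
  qed
  have "height_cond e x"
    unfolding height_cond_def
  proof (intro conjI allI impI)
    fix i j assume ij: "i < m" "j < m" "trunc e (q i) = trunc e (q j)"
    then have "node i e = node j e" "adm i e = adm j e"
      by (simp_all add: node_def adm_def)
    then show "x i = x j"
      using x ij by simp
  next
    show "x i = 0" if "i < m" "\<not> adm i e" for i
      using that x by simp
    show "x i \<noteq> 0" if "i < m" "adm i e \<and> \<not> denom e dvd parent_ram i e" for i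
      using that nonzero by blast
  next
    fix i j assume ij: "i < m" "j < m"
      and "strict_trunc e (q i) = strict_trunc e (q j) \<and> trunc e (q i) \<noteq> trunc e (q j)"
    then have st: "strict_trunc e (q i) = strict_trunc e (q j)" and tr: "trunc e (q i) \<noteq> trunc e (q j)"
      by auto
    have R: "parent_ram i e = parent_ram j e"
      by (simp add: parent_ram_def st)
    have N: "0 < branching i e"
      by (rule branching_pos [OF ij(1)])
    have "q i e \<noteq> q j e"
      using st tr trunc_eq_iff by blast
    then have K: "e \<le> KQ Q" and adm: "adm i e \<or> adm j e"
      using le_KQ_if_coeff admI ij by metis+
    show "x i ^ branching i e \<noteq> x j ^ branching i e"
    proof (cases "adm i e \<and> adm j e")
      case True
      obtain k where k: "covers k e" "node i k \<in> Vflat Q" "node i e \<in> ChA Q (node i k)"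
        using ex_parent [OF ij(1) _ e K] True by blast
      have kA: "k \<in> AQ Q"
        using k(1) by (simp add: covers_def)
      have "trunc k (q j) = trunc k (q i)"
        using st covers_strict_trunc [OF k(1)] ij by simp
      then have j: "node j e \<in> ChA Q (node i k)"
        using mem_ChA_iff [OF ij(1) kA] ij(2) k(1) True by blast
      have "node i e \<noteq> node j e"
        using tr node_eq_iff [OF ij] by simp
      then have "c (node i k) (node i e) ^ Nv Q (node i k) \<noteq> c (node i k) (node j e) ^ Nv Q (node i k)"
        using c [OF k(2)] k(3) j by (simp add: Bv_def)
      then show ?thesis
        using x ij K True parent_eq [OF k(2,3)] parent_eq [OF k(2) j] Nv_node [OF ij(1) k(1)] by simp
    next
      case False
      \<comment> \<open>\<open>Bv\<close> relates admissible nodes only. Here \<open>denom e\<close>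
        cannot divide the common parent ramification, or both nodes would be admissible; hence the
        admissible one is mandatory with a nonzero value, while the other value is 0.\<close>
      then have "\<not> denom e dvd parent_ram i e" "\<not> denom e dvd parent_ram j e"
        using adm_if_dvd_parent_ram ij R by metis+
      then have "adm l e \<longleftrightarrow> x l \<noteq> 0" if "l = i \<or> l = j" for l
      proof -
        have l: "l < m" "\<not> denom e dvd parent_ram l e"
          using that ij \<open>\<not> denom e dvd parent_ram i e\<close> R by auto
        then have "x l = 0" if "\<not> adm l e"
          using that x by simp
        then show ?thesis
          using nonzero l by blast
      qed
      then have "x i \<noteq> 0 \<and> x j = 0 \<or> x i = 0 \<and> x j \<noteq> 0"
        using False adm by blast
      then show ?thesis
        using N by (auto simp: zero_power)
    qed
  qed
  then show "height_cond e (\<lambda>i. coeff (of_tree c) i e)"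
    by (simp only: x_def [abs_def])
qed

text \<open>\<open>to_tree\<close> forgets the coefficients at non-admissible nodes; nothing is
  lost, as \<open>height_cond\<close> makes them 0.\<close>

lemma of_tree_to_tree:
  assumes a: "a \<in> BQ Q" and c: "\<And>v. v \<in> Vflat Q \<Longrightarrow> c v = to_tree v a"
  shows "of_tree c = a"
proof
  fix p :: "nat \<times> nat"
  obtain i j where p: "p = (i, j)"
    by fastforce
  show "of_tree c p = a p"
  proof (cases "i < m \<and> 1 \<le> j \<and> j \<le> sQ Q")
    case False
    then show ?thesis
      using a p unfolding mem_BQ_iff by (auto simp: of_tree_def Let_def)
  next
    case True
    then have ij: "i < m" "1 \<le> j" "j \<le> sQ Q"
      by auto
    define e :: rat where "e = of_nat j / of_nat (rQ Q)"
    have e: "0 < e" "e \<le> KQ Q"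
      using ij rQ_pos exponent_le_KQ by (auto simp: e_def)
    have coeff: "coeff b i e = b (i, j)" for b
      unfolding e_def by (rule coeff_at [OF ij(2,3)])
    have "coeff (of_tree c) i e = coeff a i e"
    proof (cases "adm i e")
      case adm: True
      obtain k where k: "covers k e" "node i k \<in> Vflat Q" "node i e \<in> ChA Q (node i k)"
        by (rule ex_parent [OF ij(1) adm e])
      then show ?thesis
        using coeff_of_tree [OF ij(1) e(1)] adm e(2) parent_eq [OF k(2,3)] c [OF k(2)]
          to_tree_node_BQ [OF a ij(1) adm e k(3)] by simp
    next
      case False
      then show ?thesis
        using coeff_of_tree [OF ij(1) e(1)] height_cond_zero [OF BQ_height_cond [OF a e(1)] ij(1)]
        by simp
    qed
    then show ?thesis
      by (simp add: coeff p)
  qed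
qed

lemma to_tree_of_tree:
  assumes v: "v \<in> Vflat Q" and c: "c v \<in> Bv Q v"
  shows "to_tree v (of_tree c) = c v"
proof
  fix w
  show "to_tree v (of_tree c) w = c v w"
  proof (cases "w \<in> ChA Q v")
    case False
    moreover have "\<forall>w. w \<notin> ChA Q v \<longrightarrow> c v w = 0"
      using c unfolding Bv_def mem_Collect_eq by (rule conjunct1)
    ultimately show ?thesis
      unfolding to_tree_def by (metis (full_types))
  next
    case True
    obtain i k e where i: "i < m" "covers k e" "v = node i k" "w = node i e" "adm i e" "0 < e" "e \<le> KQ Q"
      by (rule ChA_D [OF v True])
    \<comment> \<open>The chosen factor may differ from \<open>q i\<close>, but it passes through
      the same node, and the value of \<open>of_tree\<close> at this height depends only on the
      node.\<close>
    define i' where "i' = node_index w"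
    have i': "i' < m" "trunc e (q i') = trunc e (q i)" "node i' e = w"
      using node_index [OF i(1), of e] i(4) by (simp_all add: i'_def)
    then have "adm i' e"
      using i(5) by (simp add: adm_def)
    have "to_tree v (of_tree c) w = coeff (of_tree c) i' e"
      using to_tree_node [OF i(1,5-7)] True i(4) by (simp add: i'_def)
    also have "\<dots> = c (parent w) w"
      using coeff_of_tree [OF i'(1) i(6)] \<open>adm i' e\<close> i(7) i'(3) by simp
    also have "\<dots> = c v w"
      using parent_eq [OF v True] by simp
    finally show ?thesis .
  qed
qed

lemma continuous_on_to_tree: "continuous_on S (to_tree v)"
proof (rule continuous_on_coordinatewise_then_product)
  show "continuous_on S (\<lambda>a. to_tree v a w)" for w
    unfolding to_tree_def
    by (cases "w \<in> ChA Q v") (auto intro: continuous_on_product_then_coordinatewise continuous_on_id)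
qed

lemma continuous_on_of_tree: "continuous_on S of_tree"
proof (rule continuous_on_coordinatewise_then_product)
  fix p :: "nat \<times> nat"
  obtain i j where p: "p = (i, j)"
    by fastforce
  let ?w = "node i (of_nat j / of_nat (rQ Q))"
  have "continuous_on S (\<lambda>c. c (parent ?w) ?w)"
    by (rule continuous_on_product_then_coordinatewise
          [OF continuous_on_product_then_coordinatewise [OF continuous_on_id]])
  then show "continuous_on S (\<lambda>c. of_tree c p)"
    unfolding of_tree_def p Let_def
    by (cases "i < m \<and> 1 \<le> j \<and> j \<le> sQ Q \<and> adm i (of_nat j / of_nat (rQ Q))") auto
qed

section \<open>The product decomposition and its factors\<close>

lemma Gamma_iso_product:
  assumes b: "\<And>v. v \<in> Vflat Q \<Longrightarrow> b v \<in> Bv Q v"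
  shows "Gamma Q \<cong> product_group (Vflat Q) (\<lambda>v. fundamental_group (Bv Q v) (b v))"
proof -
  have base: "to_tree v (baseQ Q) \<in> Bv Q v" if "v \<in> Vflat Q" for v
    by (rule to_tree_in_Bv [OF baseQ_in_BQ that])
  have "Gamma Q \<cong>
      product_group (Vflat Q) (\<lambda>v. fundamental_group (Bv Q v) (to_tree v (baseQ Q)))"
    unfolding Gamma_def
  proof (rule fundamental_group_iso_product [where G = of_tree and F = to_tree])
    show "of_tree ` {c. \<forall>v\<in>Vflat Q. c v \<in> Bv Q v} \<subseteq> BQ Q"
      using of_tree_in_BQ by blast
  qed (use to_tree_in_Bv of_tree_to_tree to_tree_of_tree baseQ_in_BQ continuous_on_to_tree
      continuous_on_of_tree in blast)+
  moreover have "product_group (Vflat Q) (\<lambda>v. fundamental_group (Bv Q v) (to_tree v (baseQ Q))) \<cong>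
      product_group (Vflat Q) (\<lambda>v. fundamental_group (Bv Q v) (b v))"
    using b base by (intro iso_product_groupI fundamental_group_iso_basepoint path_connected_Bv
        group_fundamental_group)
  ultimately show ?thesis
    by (rule iso_trans)
qed

lemma fundamental_group_Bv_iso:
  assumes "v \<in> Vflat Q" "x \<in> Bv Q v"
  shows "(\<exists>n. \<exists>y\<in>Xconf n. fundamental_group (Bv Q v) x \<cong> fundamental_group (Xconf n) y) \<or>
    (\<exists>n N. 0 < N \<and> (\<exists>y\<in>Xstar n N. fundamental_group (Bv Q v) x \<cong> fundamental_group (Xstar n N) y))"
  using fundamental_group_avoid_space_iso [OF finite_ChA _ Nv_pos [OF assms(1)]
      ChA_mandatory_cases [OF assms(1)]] assms(2) unfolding Bv_eq_avoid_space by blast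

end

theorem mainTheorem16:
  fixes Q :: pit
  assumes "is_pit Q" and "compatible Q"
  shows "(\<forall>b. (\<forall>v\<in>Vflat Q. b v \<in> Bv Q v) \<longrightarrow>
            Gamma Q \<cong> product_group (Vflat Q) (\<lambda>v. fundamental_group (Bv Q v) (b v)))
       \<and> (\<forall>v\<in>Vflat Q. \<forall>x\<in>Bv Q v.
            carrier (fundamental_group (Bv Q v) x) = {\<one>\<^bsub>fundamental_group (Bv Q v) x\<^esub>}
          \<or> (\<exists>n. \<exists>y\<in>Xconf n. fundamental_group (Bv Q v) x \<cong> fundamental_group (Xconf n) y)
          \<or> (\<exists>n N. 0 < N \<and> (\<exists>y\<in>Xstar n N.
                fundamental_group (Bv Q v) x \<cong> fundamental_group (Xstar n N) y)))"
proof -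
  interpret compatible_pit Q
    by unfold_locales (fact assms)+
  show ?thesis
    using Gamma_iso_product fundamental_group_Bv_iso by blast
qed

end
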